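(* Let $K$ be an imaginary quadratic field, $D$ a positive integer, and $\alpha\in K$. Then the extended families of $\mathcal{S}_D$ whose circles pass through $\alpha$ are in one-to-one correspondence with the integral ideals of norm $D$ in the ideal class $[(\alpha,1)]^2$. An intersection angle between circles from extended families (through $\alpha$) corresponding to ideals $\mathfrak{D}$ and $\mathfrak{D}'$ is the argument of a generator of $\mathfrak{D}/\mathfrak{D}'$. Moreover, for a single family of circles through $\alpha$, the set of curvatures of its circles, each multiplied by $\sqrt{D/|\Delta|}$, is a congruence class modulo $1/\|(\alpha,1)\|$ (a coset of $\frac{1}{\|(\alpha,1)\|}\mathbb{Z}$).
   Context: $K$ is an imaginary quadratic field with ring of integers $\mathcal{O}$ and discriminant $\Delta<0$; $\sqrt{\Delta}=i\sqrt{|\Delta|}$. An oriented circle $C$ is determined by $\zeta\in\mathbb{C}$, $r,\hat r\in\mathbb{R}$ with $|\zeta|^2-r\hat r=1$; as a point set $C=\{\alpha/\beta\in\widehat{\mathbb{C}}: r|\alpha|^2-2\Re(\overline{\alpha}\beta\zeta)+\hat r|\beta|^2=0\}$; $r$ is the curvature, $\zeta$ the curvature-center, $\hat r$ the cocurvature, $\mathbf{v}_C=[\zeta\;\overline{\zeta}\;\hat r\;r]$. For vectors $v,w$, $\langle v,w\rangle_Q=\tfrac12(v_1\overline{w_1}+v_2\overline{w_2}-v_3\overline{w_4}-v_4\overline{w_3})$; two intersecting oriented circles $C,C'$ meet at angle $\arccos\langle\mathbf{v}_C,\mathbf{v}_{C'}\rangle_Q$. $\mathcal{S}_D$ is the set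 of oriented circles with $i\sqrt{D}\,\mathbf{v}_C\in\mathcal{O}^2\times\sqrt{\Delta}\mathbb{Z}^2$. A family is a maximal subset of $\mathcal{S}_D$ in which any two circles satisfy $\langle\mathbf{v}_C,\mathbf{v}_{C'}\rangle_Q=1$ (they are mutually tangent at a common point). An extended family is a maximal subset of $\mathcal{S}_D$ in which any two circles intersect at a fixed common point with angle $\theta$ satisfying $e^{i\theta}\in\mathcal{O}$. $(\alpha,1)$ is the fractional ideal generated by $\alpha$ and $1$, $\|\cdot\|$ is the ideal norm, and $[\mathfrak{a}]$ is the ideal class of $\mathfrak{a}$.
   Formalization: The intersection angle, taken as the unoriented arccos value in [0,π], is shown to be the absolute value of the argument of a generator of D/D' (the signed claim fails when D and D' are swapped); families and extended families are taken to be nonempty. *)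

theory Defs
  imports
    "HOL-Analysis.Analysis"
    "HOL-Algebra.Embedded_Algebras"
    "HOL-Algebra.Ideal_Product"
    "HOL-Library.Set_Algebras"
begin

section \<open>Imaginary quadratic fields and their ideals\<close>

text \<open>
  Number fields are subfields of the complex numbers; this fixes the embedding that is
  implicit in the convention on the square root of the discriminant.
\<close>

definition complex_field :: "complex ring" where
  "complex_field = \<lparr>carrier = UNIV, mult = (*), one = 1, zero = 0, add = (+)\<rparr>"

definition imaginary_quadratic_field :: "complex set \<Rightarrow> bool" where
  "imaginary_quadratic_field K \<longleftrightarrow>
     subfield K complex_field \<and> ring.dimension complex_field 2 \<rat> K \<and> \<not> K \<subseteq> \<real>"

definition integers_of :: "complex set \<Rightarrow> complex set" where
  "integers_of K = {x \<in> K. algebraic_int x}"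

definition ring_of_integers :: "complex set \<Rightarrow> complex ring" where
  "ring_of_integers K = complex_field\<lparr>carrier := integers_of K\<rparr>"

text \<open>
  The discriminant is the squared determinant of the matrix of conjugates of an integral
  basis. Two generators of the additive group of integers form a basis, since that group
  is free of rank two; the nontrivial automorphism of the field is complex conjugation.
\<close>

definition discriminant :: "complex set \<Rightarrow> int" where
  "discriminant K = (THE d. \<exists>u v. integers_of K = {of_int a * u + of_int b * v |a b. True} \<and>
                               of_int d = (u * cnj v - v * cnj u)\<^sup>2)"

definition sqrt_disc :: "complex set \<Rightarrow> complex" where
  "sqrt_disc K = \<i> * of_real (sqrt (of_int \<bar>discriminant K\<bar>))"

definition integral_ideal :: "complex set \<Rightarrow> complex set \<Rightarrow> bool" where
  "integral_ideal K I \<longleftrightarrow> ideal I (ring_of_integers K) \<and> I \<noteq> {0}"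

definition fractional_ideal :: "complex set \<Rightarrow> complex set \<Rightarrow> bool" where
  "fractional_ideal K I \<longleftrightarrow> (\<exists>c \<in> integers_of K - {0}. integral_ideal K (c *o I))"

definition ideal_gen2 :: "complex set \<Rightarrow> complex \<Rightarrow> complex \<Rightarrow> complex set" where
  "ideal_gen2 K a b = {x * a + y * b |x y. x \<in> integers_of K \<and> y \<in> integers_of K}"

definition is_generator :: "complex set \<Rightarrow> complex \<Rightarrow> complex set \<Rightarrow> bool" where
  "is_generator K g I \<longleftrightarrow> I = g *o integers_of K"

definition ideal_mult :: "complex set \<Rightarrow> complex set \<Rightarrow> complex set" where
  "ideal_mult I J = ideal_prod complex_field I J"

definition ideal_inverse :: "complex set \<Rightarrow> complex set \<Rightarrow> complex set" where
  "ideal_inverse K I = {x \<in> K. \<forall>y \<in> I. x * y \<in> integers_of K}"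

definition ideal_quotient :: "complex set \<Rightarrow> complex set \<Rightarrow> complex set \<Rightarrow> complex set" where
  "ideal_quotient K I J = ideal_mult I (ideal_inverse K J)"

definition ideal_class :: "complex set \<Rightarrow> complex set \<Rightarrow> complex set set" where
  "ideal_class K I = {J. fractional_ideal K J \<and> (\<exists>c \<in> K - {0}. J = c *o I)}"

definition subgroup_index :: "complex set \<Rightarrow> complex set \<Rightarrow> nat" where
  "subgroup_index A B = card (A // {(x, y). x \<in> A \<and> y \<in> A \<and> x - y \<in> B})"

text \<open>
  The norm of a fractional ideal is the generalized index of the ideal in the ring of
  integers; for an integral ideal the denominator is 1.
\<close>

definition ideal_norm :: "complex set \<Rightarrow> complex set \<Rightarrow> real" where
  "ideal_norm K I = real (subgroup_index (integers_of K) (integers_of K \<inter> I)) /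
                    real (subgroup_index I (integers_of K \<inter> I))"


section \<open>Oriented circles\<close>

datatype circle = Circle (center: complex) (curvature: real) (cocurvature: real)

definition oriented_circle :: "circle \<Rightarrow> bool" where
  "oriented_circle C \<longleftrightarrow> (cmod (center C))\<^sup>2 - curvature C * cocurvature C = 1"

text \<open>The extended complex plane is \<^typ>\<open>complex option\<close>, with \<^term>\<open>None\<close> for infinity.\<close>

definition proj_point :: "complex \<Rightarrow> complex \<Rightarrow> complex option" where
  "proj_point a b = (if b = 0 then None else Some (a / b))"

definition circle_points :: "circle \<Rightarrow> complex option set" where
  "circle_points C = {proj_point a b |a b. (a, b) \<noteq> (0, 0) \<and>
     curvature C * (cmod a)\<^sup>2 - 2 * Re (cnj a * b * center C) + cocurvature C * (cmod b)\<^sup>2 = 0}"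

definition circle_vec :: "circle \<Rightarrow> complex ^ 4" where
  "circle_vec C = vector [center C, cnj (center C),
                          of_real (cocurvature C), of_real (curvature C)]"

definition inner_Q :: "complex ^ 4 \<Rightarrow> complex ^ 4 \<Rightarrow> complex" where
  "inner_Q v w = (v $ 1 * cnj (w $ 1) + v $ 2 * cnj (w $ 2)
                  - v $ 3 * cnj (w $ 4) - v $ 4 * cnj (w $ 3)) / 2"

text \<open>
  The form is real on circle vectors. The angle is unoriented, in the interval from 0 to pi,
  and meaningful only for circles that intersect.
\<close>

definition circle_angle :: "circle \<Rightarrow> circle \<Rightarrow> real" where
  "circle_angle C C' = arccos (Re (inner_Q (circle_vec C) (circle_vec C')))"

definition circles :: "complex set \<Rightarrow> nat \<Rightarrow> circle set" where
  "circles K D = {C. oriented_circle C \<and>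
     (let v = (\<i> * of_real (sqrt (real D))) *s circle_vec C in
        v $ 1 \<in> integers_of K \<and> v $ 2 \<in> integers_of K \<and>
        v $ 3 \<in> sqrt_disc K *o \<int> \<and> v $ 4 \<in> sqrt_disc K *o \<int>)}"

definition maximal_set :: "('a set \<Rightarrow> bool) \<Rightarrow> 'a set \<Rightarrow> bool" where
  "maximal_set P F \<longleftrightarrow> P F \<and> (\<forall>G. P G \<and> F \<subseteq> G \<longrightarrow> G = F)"

text \<open>
  Families and extended families are nonempty: \<^term>\<open>circles K D\<close> can be empty (for instance
  for the Gaussian field and 3), and then the empty set would be a maximal
  subset, vacuously passing through every point.
\<close>

definition is_family :: "complex set \<Rightarrow> nat \<Rightarrow> circle set \<Rightarrow> bool" where
  "is_family K D = maximal_set (\<lambda>F. F \<noteq> {} \<and> F \<subseteq> circles K D \<and>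
     (\<forall>C \<in> F. \<forall>C' \<in> F. inner_Q (circle_vec C) (circle_vec C') = 1))"

definition is_extended_family :: "complex set \<Rightarrow> nat \<Rightarrow> circle set \<Rightarrow> bool" where
  "is_extended_family K D = maximal_set (\<lambda>F. F \<noteq> {} \<and> F \<subseteq> circles K D \<and>
     (\<exists>z. \<forall>C \<in> F. \<forall>C' \<in> F. z \<in> circle_points C \<inter> circle_points C' \<and>
        cis (circle_angle C C') \<in> integers_of K))"

definition passes_through :: "circle set \<Rightarrow> complex \<Rightarrow> bool" where
  "passes_through F \<alpha> \<longleftrightarrow> (\<forall>C \<in> F. Some \<alpha> \<in> circle_points C)"

end

theory Submission
  imports Defs
begin

text \<open>
  A circle of \<open>\<S>\<^sub>D\<close> through \<open>\<alpha>\<close> is determined by its unit normal vector at \<open>\<alpha>\<close>, scaled by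
  \<open>i \<surd>D\<close> to \<open>\<eta> \<in> K\<close> with \<open>|\<eta>|\<^sup>2 = D\<close>, and by an integer \<open>k\<close> proportional to its curvature. Let
  \<open>n\<close> be the common denominator of the trace and the norm of \<open>\<alpha>\<close>. Then the product of
  \<open>\<aa> = (\<alpha>, 1)\<close> and its conjugate is \<open>(1/n)\<O>\<close>, so \<open>\<aa>\<close> has norm \<open>1/n\<close>. For given \<open>\<eta>\<close> a suitable
  \<open>k\<close> exists exactly if \<open>n (cnj \<eta>) \<aa>\<^sup>2\<close> is an integral ideal, necessarily of norm \<open>D\<close>, and \<open>k\<close> is
  then unique modulo \<open>n\<close>: the circles with the same \<open>\<eta>\<close> form a family. The angle between two
  circles is the argument of the quotient of their \<open>\<eta>\<close>, so an extended family collects the circles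
  whose \<open>\<eta>\<close> differ by a unit, that is, those with the same ideal.
\<close>

section \<open>Lattices in the complex plane\<close>

text \<open>The obstacle is to solve for \<open>k\<close>: integrality of the curvature-center is a
  condition over \<open>\<O>\<close>, while \<open>k\<close> is a rational integer. The form
  \<open>alt_form\<close> removes it. Divided by the square root of the discriminant, it is
  unimodular on \<open>\<O>\<close>, so a complex number is integral as soon as its values against
  \<open>\<O>\<close> are integers, and every condition on \<open>k\<close> becomes a congruence.
  The same square root scales the last two coordinates in \<open>circles\<close>. The number n comes
  from the product of \<open>\<AA>\<close> and its conjugate: it contains 1, the trace t/n and the
  norm m/n of \<alpha>, where n, t, m have no common factor. The Bezout coefficients of these three
  numbers give explicit elements that show \<open>\<AA>\<close> and its square to be invertible.
  Norms of ideals are computed as ratios of covolumes, since scaling by \<open>c\<close> multiplies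
  a covolume by the square of |c|. The conjugate of \<eta> in the ideal reverses the argument of
  every quotient, which an unoriented angle does not see.\<close>

definition add_subgroup :: "complex set \<Rightarrow> bool" where
  "add_subgroup H \<longleftrightarrow> 0 \<in> H \<and> (\<forall>x\<in>H. \<forall>y\<in>H. x - y \<in> H)"

lemma add_subgroup_diff: "add_subgroup H \<Longrightarrow> x \<in> H \<Longrightarrow> y \<in> H \<Longrightarrow> x - y \<in> H"
  by (simp add: add_subgroup_def)

lemma add_subgroup_zero: "add_subgroup H \<Longrightarrow> 0 \<in> H"
  by (simp add: add_subgroup_def)

lemma add_subgroup_minus: "add_subgroup H \<Longrightarrow> x \<in> H \<Longrightarrow> - x \<in> H"
  unfolding add_subgroup_def by (metis diff_0)

lemma add_subgroup_add: "add_subgroup H \<Longrightarrow> x \<in> H \<Longrightarrow> y \<in> H \<Longrightarrow> x + y \<in> H"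
  using add_subgroup_diff[of H x "- y"] add_subgroup_minus[of H y] by simp

lemma add_subgroup_of_int:
  assumes "add_subgroup H" "x \<in> H"
  shows "of_int n * x \<in> H"
proof -
  have nat: "of_nat m * x \<in> H" for m
    by (induction m) (use assms in \<open>auto simp: distrib_right intro: add_subgroup_add add_subgroup_zero\<close>)
  show ?thesis
  proof (cases "n \<ge> 0")
    case True
    then show ?thesis using nat[of "nat n"] by simp
  next
    case False
    then show ?thesis
      using add_subgroup_minus[OF assms(1) nat[of "nat (- n)"]] by simp
  qed
qed

text \<open>Division with remainder by the least positive element. It supplies the pivots of a
  sublattice basis and the least common denominator of two rationals.\<close>

lemma int_subgroup_generator:
  fixes S :: "int set"
  assumes "k \<in> S" "k > 0" and diff: "\<And>x y. x \<in> S \<Longrightarrow> y \<in> S \<Longrightarrow> x - y \<in> S"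
  shows "\<exists>g>0. S = {x. g dvd x}"
proof -
  define g where "g = (LEAST m. m > 0 \<and> int m \<in> S)"
  have ex: "\<exists>m. m > 0 \<and> int m \<in> S"
    using assms(1,2) by (intro exI[of _ "nat k"]) auto
  have g: "g > 0" "int g \<in> S"
    using LeastI_ex[OF ex] by (auto simp: g_def)
  have least: "\<not> (m > 0 \<and> int m \<in> S)" if "m < g" for m
    using not_less_Least that unfolding g_def by blast
  have zero: "0 \<in> S" using diff[OF g(2) g(2)] by simp
  have minus: "- x \<in> S" if "x \<in> S" for x using diff[OF zero that] by simp
  have add: "x + y \<in> S" if "x \<in> S" "y \<in> S" for x y
    using diff[OF that(1) minus[OF that(2)]] by simp
  have nmult: "int m * int g \<in> S" for m
    by (induction m) (use zero g add in \<open>auto simp: distrib_right\<close>)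
  have mult: "q * int g \<in> S" for q
  proof (cases "q \<ge> 0")
    case True then show ?thesis using nmult[of "nat q"] by simp
  next
    case False then show ?thesis using minus[OF nmult[of "nat (- q)"]] by simp
  qed
  have "int g dvd x" if "x \<in> S" for x
  proof -
    have "x mod int g \<in> S"
      using diff[OF that mult[of "x div int g"]] by (simp add: minus_div_mult_eq_mod)
    moreover have "x mod int g \<ge> 0" "x mod int g < int g" using g by auto
    ultimately have "x mod int g = 0"
      using least[of "nat (x mod int g)"] by auto
    then show ?thesis by auto
  qed
  moreover have "x \<in> S" if "int g dvd x" for x
    using that mult by (metis dvd_div_mult_self)
  ultimately show ?thesis using g by (intro exI[of _ "int g"]) auto
qed

section \<open>Counting cosets\<close>

abbreviation coset_rel :: "complex set \<Rightarrow> complex set \<Rightarrow> (complex \<times> complex) set" where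
  "coset_rel A B \<equiv> {(x, y). x \<in> A \<and> y \<in> A \<and> x - y \<in> B}"

lemma equiv_coset_rel:
  assumes "add_subgroup B"
  shows "equiv A (coset_rel A B)"
proof (rule equivI)
  show "coset_rel A B \<subseteq> A \<times> A" by auto
  show "refl_on A (coset_rel A B)"
    using add_subgroup_zero[OF assms] by (auto simp: refl_on_def)
  show "sym (coset_rel A B)"
  proof (rule symI)
    fix x y assume "(x, y) \<in> coset_rel A B"
    then show "(y, x) \<in> coset_rel A B"
      using add_subgroup_minus[OF assms, of "x - y"] by simp
  qed
  show "trans (coset_rel A B)"
  proof (rule transI)
    fix x y z assume "(x, y) \<in> coset_rel A B" "(y, z) \<in> coset_rel A B"
    then show "(x, z) \<in> coset_rel A B"
      using add_subgroup_add[OF assms, of "x - y" "y - z"] by simp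
  qed
qed

lemma coset_eq_iff:
  assumes "add_subgroup B" "x \<in> A" "y \<in> A"
  shows "coset_rel A B `` {x} = coset_rel A B `` {y} \<longleftrightarrow> x - y \<in> B"
  using eq_equiv_class_iff[OF equiv_coset_rel[OF assms(1)] assms(2,3)] assms by auto

text \<open>The bijection sends a value of \<open>g\<close> to the value of \<open>h\<close> at any
  preimage. It also covers infinite images, so indices can be compared before they are known to be
  finite.\<close>

lemma card_image_eq_if_same_kernel:
  assumes "\<And>x y. x \<in> A \<Longrightarrow> y \<in> A \<Longrightarrow> g x = g y \<longleftrightarrow> h x = h y"
  shows "card (g ` A) = card (h ` A)"
proof (rule bij_betw_same_card)
  let ?i = "inv_into A g"
  have i: "?i (g x) \<in> A" "g (?i (g x)) = g x" if "x \<in> A" for x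
    using that by (auto intro: inv_into_into f_inv_into_f)
  then have h: "h (?i (g x)) = h x" if "x \<in> A" for x
    using assms that by metis
  show "bij_betw (\<lambda>s. h (?i s)) (g ` A) (h ` A)"
    unfolding bij_betw_def
  proof
    show "inj_on (\<lambda>s. h (?i s)) (g ` A)"
      using h assms by (auto simp: inj_on_def)
    show "(\<lambda>s. h (?i s)) ` g ` A = h ` A"
      using h by (auto simp: image_image)
  qed
qed

text \<open>Here \<open>f\<close> parametrizes representatives, and \<open>h\<close> labels the
  parameters so that equal labels mean equal cosets. The labels are the parameters themselves for a
  residue system, and cosets of another group when two quotients are compared.\<close>

lemma subgroup_index_eq_card_image:
  assumes B: "add_subgroup B" and "f ` I \<subseteq> A"
    and reps: "\<And>y. y \<in> A \<Longrightarrow> \<exists>i\<in>I. y - f i \<in> B"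
    and h: "\<And>i j. i \<in> I \<Longrightarrow> j \<in> I \<Longrightarrow> h i = h j \<longleftrightarrow> f i - f j \<in> B"
  shows "subgroup_index A B = card (h ` I)"
proof -
  let ?c = "\<lambda>x. coset_rel A B `` {x}"
  have "A // coset_rel A B = (\<lambda>i. ?c (f i)) ` I"
  proof (intro equalityI subsetI)
    fix X assume "X \<in> A // coset_rel A B"
    then obtain y where y: "y \<in> A" "X = ?c y" by (auto simp: quotient_def)
    with reps obtain i where i: "i \<in> I" "y - f i \<in> B" by blast
    then have "X = ?c (f i)"
      unfolding y using coset_eq_iff[OF B y(1)] assms(2) by blast
    with i show "X \<in> (\<lambda>i. ?c (f i)) ` I" by blast
  next
    fix X assume "X \<in> (\<lambda>i. ?c (f i)) ` I"
    then obtain i where i: "i \<in> I" "X = ?c (f i)" by (rule imageE)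
    then have "f i \<in> A" using assms(2) by blast
    then show "X \<in> A // coset_rel A B"
      unfolding i(2) by (rule quotientI)
  qed
  moreover have "card ((\<lambda>i. ?c (f i)) ` I) = card (h ` I)"
  proof (rule card_image_eq_if_same_kernel)
    fix i j assume ij: "i \<in> I" "j \<in> I"
    then have "f i \<in> A" "f j \<in> A" using assms(2) by auto
    from coset_eq_iff[OF B this] h[OF ij] show "?c (f i) = ?c (f j) \<longleftrightarrow> h i = h j" by simp
  qed
  ultimately show ?thesis by (simp add: subgroup_index_def)
qed

text \<open>The isomorphism theorem for the map from \<open>A\<close> to \<open>C\<close> modulo
  \<open>B\<close>: it is onto by \<open>reps\<close>, and its kernel is the preimage of
  \<open>B\<close>. It is applied with \<open>f\<close> the multiplication by \<alpha>.\<close>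

lemma subgroup_index_preimage:
  assumes A: "add_subgroup A" and B: "add_subgroup B"
    and f: "\<And>x y. f (x - y) = f x - f y" and "f ` A \<subseteq> C"
    and reps: "\<And>y. y \<in> C \<Longrightarrow> \<exists>x\<in>A. y - f x \<in> B"
  shows "subgroup_index C B = subgroup_index A {x \<in> A. f x \<in> B}"
proof -
  let ?B = "{x \<in> A. f x \<in> B}"
  let ?h = "\<lambda>x. coset_rel A ?B `` {x}"
  have f0: "f 0 = 0" using f[of 0 0] by simp
  have B': "add_subgroup ?B"
    using A B f f0 by (auto simp: add_subgroup_def)
  have eq: "?h x = ?h y \<longleftrightarrow> f x - f y \<in> B" if "x \<in> A" "y \<in> A" for x y
    using coset_eq_iff[OF B' that] add_subgroup_diff[OF A that] f by simp
  have "subgroup_index C B = card (?h ` A)"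
    by (rule subgroup_index_eq_card_image[OF B assms(4) reps]) (use eq in blast)+
  moreover have "subgroup_index A ?B = card (?h ` A)"
    by (rule subgroup_index_eq_card_image[OF B', where f = "\<lambda>x. x"])
       (use coset_eq_iff[OF B'] add_subgroup_zero[OF B'] in auto)
  ultimately show ?thesis by simp
qed

lemma subgroup_index_self:
  assumes "add_subgroup A"
  shows "subgroup_index A A = 1"
proof -
  have "subgroup_index A A = card ((\<lambda>_. ()) ` {()})"
    by (rule subgroup_index_eq_card_image[OF assms, where f = "\<lambda>_. 0"])
       (use add_subgroup_zero[OF assms] in auto)
  then show ?thesis by simp
qed

section \<open>Covolumes of lattices\<close>

definition int_span :: "complex \<Rightarrow> complex \<Rightarrow> complex set" where
  "int_span u v = {of_int a * u + of_int b * v |a b. True}"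

text \<open>The number is the area of a fundamental parallelogram. Its positivity expresses that
  \<open>u\<close> and \<open>v\<close> are linearly independent over the reals.\<close>

definition has_covolume :: "complex set \<Rightarrow> real \<Rightarrow> bool" where
  "has_covolume L c \<longleftrightarrow> (\<exists>u v. L = int_span u v \<and> c = \<bar>Im (u * cnj v)\<bar> \<and> c > 0)"

lemma int_spanI: "x = of_int a * u + of_int b * v \<Longrightarrow> x \<in> int_span u v"
  by (auto simp: int_span_def)

lemma add_subgroup_int_span: "add_subgroup (int_span u v)"
  unfolding add_subgroup_def
proof (intro conjI ballI)
  show "0 \<in> int_span u v" by (rule int_spanI[of _ 0 _ 0]) simp
next
  fix x y assume "x \<in> int_span u v" "y \<in> int_span u v"
  then obtain a b a' b' where "x = of_int a * u + of_int b * v" "y = of_int a' * u + of_int b' * v"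
    by (auto simp: int_span_def)
  then show "x - y \<in> int_span u v"
    by (intro int_spanI[of _ "a - a'" _ "b - b'"]) (simp add: algebra_simps)
qed

text \<open>The form is alternating and bilinear over the reals, so a change of basis multiplies it
  by the determinant.\<close>

lemma Im_cross_combination:
  "Im ((of_int a * u + of_int b * v) * cnj (of_int p * u + of_int q * v))
     = of_int (a * q - b * p) * Im (u * cnj v)"
  by (simp add: algebra_simps)

lemma Im_of_real_times: "Im (of_real r * z) = r * Im z"
  by simp

lemma has_covolume_pos: "has_covolume L c \<Longrightarrow> c > 0"
  by (auto simp: has_covolume_def)

lemma has_covolume_add_subgroup: "has_covolume L c \<Longrightarrow> add_subgroup L"
  by (auto simp: has_covolume_def add_subgroup_int_span)

text \<open>Each basis is an integral combination of the other, so each of the two areas is a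
  positive integral multiple of the other.\<close>

lemma has_covolume_unique:
  assumes "has_covolume L c" "has_covolume L c'"
  shows "c = c'"
proof -
  have mult: "\<exists>n. c = of_int n * c' \<and> n > 0" if "has_covolume L c" "has_covolume L c'" for c c'
  proof -
    obtain u v where L: "L = int_span u v" "c = \<bar>Im (u * cnj v)\<bar>" "c > 0"
      using \<open>has_covolume L c\<close> by (auto simp: has_covolume_def)
    obtain u' v' where L': "L = int_span u' v'" "c' = \<bar>Im (u' * cnj v')\<bar>" "c' > 0"
      using \<open>has_covolume L c'\<close> by (auto simp: has_covolume_def)
    have "u \<in> L" "v \<in> L"
      unfolding L by (auto intro: int_spanI[of _ 1 _ 0] int_spanI[of _ 0 _ 1])
    then obtain a b p q where "u = of_int a * u' + of_int b * v'" "v = of_int p * u' + of_int q * v'"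
      unfolding L' int_span_def by blast
    then have "c = \<bar>of_int (a * q - b * p) * Im (u' * cnj v')\<bar>"
      unfolding L by (simp only: Im_cross_combination)
    then have "c = of_int \<bar>a * q - b * p\<bar> * c'"
      unfolding L' by (simp add: abs_mult)
    moreover from this have "\<bar>a * q - b * p\<bar> > 0" using \<open>c > 0\<close> \<open>c' > 0\<close>
      by (simp only: zero_less_mult_iff of_int_0_less_iff) linarith
    ultimately show ?thesis by blast
  qed
  obtain n m :: int where nm: "c = of_int n * c'" "n > 0" "c' = of_int m * c" "m > 0"
    using mult[OF assms] mult[OF assms(2,1)] by blast
  then have "c = of_int (n * m) * c" by (metis mult.assoc of_int_mult)
  then have "real_of_int (n * m) = 1" using has_covolume_pos[OF assms(1)] by simp
  then have "n * m = 1" by linarith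
  then have "n = 1" using nm by (simp add: zmult_eq_1_iff)
  then show ?thesis using nm by simp
qed

lemma has_covolume_scale:
  assumes "has_covolume L c" "s \<noteq> 0"
  shows "has_covolume (s *o L) ((cmod s)\<^sup>2 * c)"
proof -
  obtain u v where L: "L = int_span u v" "c = \<bar>Im (u * cnj v)\<bar>" "c > 0"
    using assms(1) by (auto simp: has_covolume_def)
  have "s *o L = int_span (s * u) (s * v)"
  proof (intro equalityI subsetI)
    fix x assume "x \<in> s *o L"
    then obtain a b where "x = s * (of_int a * u + of_int b * v)"
      by (auto simp: L int_span_def elt_set_times_def)
    then show "x \<in> int_span (s * u) (s * v)"
      by (intro int_spanI[of _ a _ b]) (simp add: algebra_simps)
  next
    fix x assume "x \<in> int_span (s * u) (s * v)"
    then obtain a b where "x = s * (of_int a * u + of_int b * v)"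
      by (auto simp: int_span_def algebra_simps)
    then show "x \<in> s *o L"
      unfolding L by (auto intro: int_spanI)
  qed
  moreover have "s * u * cnj (s * v) = of_real ((cmod s)\<^sup>2) * (u * cnj v)"
    using complex_norm_square[of s] by (simp add: mult_ac)
  then have "\<bar>Im (s * u * cnj (s * v))\<bar> = (cmod s)\<^sup>2 * c"
    unfolding L by (simp only: Im_of_real_times abs_mult) simp
  ultimately show ?thesis
    using assms L unfolding has_covolume_def by (intro exI[of _ "s * u"] exI[of _ "s * v"]) auto
qed

lemma has_covolume_cnj:
  assumes "has_covolume L c"
  shows "has_covolume (cnj ` L) c"
proof -
  obtain u v where L: "L = int_span u v" "c = \<bar>Im (u * cnj v)\<bar>" "c > 0"
    using assms(1) by (auto simp: has_covolume_def)
  have "cnj ` L = int_span (cnj u) (cnj v)"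
  proof (intro equalityI subsetI)
    fix x assume "x \<in> cnj ` L"
    then obtain a b where "x = cnj (of_int a * u + of_int b * v)"
      by (auto simp: L int_span_def)
    then show "x \<in> int_span (cnj u) (cnj v)"
      by (intro int_spanI[of _ a _ b]) simp
  next
    fix x assume "x \<in> int_span (cnj u) (cnj v)"
    then obtain a b where "x = cnj (of_int a * u + of_int b * v)"
      by (auto simp: int_span_def)
    then show "x \<in> cnj ` L"
      unfolding L by (blast intro: int_spanI)
  qed
  moreover have "\<bar>Im (cnj u * cnj (cnj v))\<bar> = c"
    unfolding L by (simp add: algebra_simps)
  ultimately show ?thesis
    using L unfolding has_covolume_def by (intro exI[of _ "cnj u"] exI[of _ "cnj v"]) auto
qed

text \<open>Hermite normal form: \<open>H\<close> has a triangular basis \<open>e * u\<close>,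
  \<open>a0 * u + g * v\<close>, whose determinant \<open>e * g\<close> is also the number of
  cosets. The multiplier \<open>k\<close> guarantees that both pivots exist.\<close>

lemma has_covolume_subgroup:
  assumes cov: "has_covolume L c" and H: "add_subgroup H" "H \<subseteq> L"
    and "k > 0" and k: "\<And>x. x \<in> L \<Longrightarrow> of_int k * x \<in> H"
  shows "has_covolume H (real (subgroup_index L H) * c)"
proof -
  obtain u v where L: "L = int_span u v" "c = \<bar>Im (u * cnj v)\<bar>" "c > 0"
    using cov by (auto simp: has_covolume_def)
  have uv: "u \<in> L" "v \<in> L"
    unfolding L by (auto intro: int_spanI[of _ 1 _ 0] int_spanI[of _ 0 _ 1])
  have "\<exists>e>0. {a. of_int a * u \<in> H} = {x. e dvd x}"
    by (rule int_subgroup_generator[of k])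
       (use k uv \<open>k > 0\<close> add_subgroup_diff[OF H(1)] in \<open>auto simp: left_diff_distrib\<close>)
  then obtain e where e: "e > 0" "\<And>a. of_int a * u \<in> H \<longleftrightarrow> e dvd a" by auto
  have "\<exists>g>0. {b. \<exists>a. of_int a * u + of_int b * v \<in> H} = {x. g dvd x}"
  proof (rule int_subgroup_generator[of k])
    show "k \<in> {b. \<exists>a. of_int a * u + of_int b * v \<in> H}"
      using k[OF uv(2)] by (auto intro!: exI[of _ 0])
    fix x y assume "x \<in> {b. \<exists>a. of_int a * u + of_int b * v \<in> H}" "y \<in> {b. \<exists>a. of_int a * u + of_int b * v \<in> H}"
    then obtain a a' where "of_int a * u + of_int x * v \<in> H" "of_int a' * u + of_int y * v \<in> H" by auto
    from add_subgroup_diff[OF H(1) this]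
    have "of_int (a - a') * u + of_int (x - y) * v \<in> H" by (simp add: algebra_simps)
    then show "x - y \<in> {b. \<exists>a. of_int a * u + of_int b * v \<in> H}" by blast
  qed fact
  then obtain g where g: "g > 0" "\<And>b. (\<exists>a. of_int a * u + of_int b * v \<in> H) \<longleftrightarrow> g dvd b" by auto
  from g(2)[of g] obtain a0 where a0: "of_int a0 * u + of_int g * v \<in> H" by auto
  define h where "h = of_int a0 * u + of_int g * v"
  \<comment> \<open>Subtracting \<open>b div g\<close> times \<open>h\<close> removes the
    \<open>v\<close> part and leaves a multiple of \<open>u\<close>, which \<open>e\<close>
    decides.\<close>
  have mem: "of_int a * u + of_int b * v \<in> H \<longleftrightarrow> g dvd b \<and> e dvd (a - (b div g) * a0)" for a b
  proof (cases "g dvd b")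
    case True
    have eq: "of_int a * u + of_int b * v = of_int (a - (b div g) * a0) * u + of_int (b div g) * h"
    proof -
      have "(of_int b :: complex) = of_int (b div g * g)" using True by simp
      then show ?thesis unfolding h_def by (simp add: algebra_simps)
    qed
    have hm: "of_int (b div g) * h \<in> H"
      using add_subgroup_of_int[OF H(1) a0] by (simp add: h_def)
    have "of_int a * u + of_int b * v \<in> H \<longleftrightarrow> of_int (a - (b div g) * a0) * u \<in> H"
      unfolding eq using hm add_subgroup_add[OF H(1) _ hm] add_subgroup_diff[OF H(1) _ hm]
      by fastforce
    then show ?thesis using e(2)[of "a - (b div g) * a0"] True by blast
  next
    case False
    then show ?thesis using g by blast
  qed
  have "H = int_span (of_int e * u) h"
  proof (intro equalityI subsetI)
    fix x assume "x \<in> H"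
    with H(2) obtain a b where x: "x = of_int a * u + of_int b * v"
      unfolding L int_span_def by blast
    with \<open>x \<in> H\<close> mem have "g dvd b" "e dvd (a - (b div g) * a0)" by auto
    then obtain i j where ij: "b = g * j" "a - (b div g) * a0 = e * i" by (metis dvdE)
    then have "a = e * i + j * a0" using g by auto
    then show "x \<in> int_span (of_int e * u) h"
      by (intro int_spanI[of _ i _ j]) (simp add: x h_def ij algebra_simps)
  next
    fix x assume "x \<in> int_span (of_int e * u) h"
    then obtain a b where x: "x = of_int a * (of_int e * u) + of_int b * h"
      by (auto simp: int_span_def)
    have "of_int e * u \<in> H" using e by auto
    then show "x \<in> H" unfolding x using a0 h_def
      by (auto intro!: add_subgroup_add[OF H(1)] add_subgroup_of_int[OF H(1)])
  qed
  moreover have "\<bar>Im (of_int e * u * cnj h)\<bar> = of_int (e * g) * c"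
    using Im_cross_combination[of e u 0 v a0 g] e(1) g(1) unfolding L h_def
    by (simp add: abs_mult)
  moreover have "real_of_int (e * g) * c > 0"
    using e(1) g(1) L by simp
  ultimately have cov_H: "has_covolume H (of_int (e * g) * c)"
    unfolding has_covolume_def by (intro exI[of _ "of_int e * u"] exI[of _ h]) auto
  let ?I = "{0..<e} \<times> {0..<g}"
  have "subgroup_index L H = card ((\<lambda>p. p) ` ?I)"
  proof (rule subgroup_index_eq_card_image[OF H(1), where f = "\<lambda>(i,j). of_int i * u + of_int j * v"])
    show "(\<lambda>(i, j). of_int i * u + of_int j * v) ` ?I \<subseteq> L"
      unfolding L int_span_def by auto
    fix y assume "y \<in> L"
    then obtain a b where y: "y = of_int a * u + of_int b * v" unfolding L int_span_def by blast
    \<comment> \<open>The coefficient of \<open>u\<close> must be reduced modulo \<open>e\<close>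
      after the multiple of \<open>h\<close> has been removed, because \<open>h\<close> itself
      contains \<open>a0 * u\<close>.\<close>
    define a' where "a' = a - (b div g) * a0"
    define i where "i = a' mod e"
    define j where "j = b mod g"
    have ij: "(i, j) \<in> ?I" using e(1) g(1) by (simp add: i_def j_def)
    have "e dvd a' - i" "b - j = g * (b div g)"
      unfolding i_def j_def by (rule dvd_minus_mod) (rule minus_mod_eq_mult_div)
    moreover from this have "(b - j) div g = b div g" using g(1) by simp
    moreover have "a - i - (b div g) * a0 = a' - i" unfolding a'_def by simp
    ultimately have "of_int (a - i) * u + of_int (b - j) * v \<in> H"
      unfolding mem by (metis dvd_triv_left)
    moreover have "of_int (a - i) * u + of_int (b - j) * v = y - (of_int i * u + of_int j * v)"
      by (simp add: y algebra_simps)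
    ultimately have "y - (case (i, j) of (i, j) \<Rightarrow> of_int i * u + of_int j * v) \<in> H"
      by simp
    with ij show "\<exists>i\<in>?I. y - (case i of (i, j) \<Rightarrow> of_int i * u + of_int j * v) \<in> H"
      by blast
  next
    fix p q assume pq: "p \<in> ?I" "q \<in> ?I"
    obtain i j i' j' where [simp]: "p = (i,j)" "q = (i',j')" by (cases p, cases q) auto
    have "(case p of (i, j) \<Rightarrow> of_int i * u + of_int j * v) - (case q of (i, j) \<Rightarrow> of_int i * u + of_int j * v)
        = of_int (i - i') * u + of_int (j - j') * v" by (simp add: algebra_simps)
    moreover have "of_int (i - i') * u + of_int (j - j') * v \<in> H \<longleftrightarrow> i = i' \<and> j = j'"
    proof -
      have j: "g dvd j - j' \<longleftrightarrow> j = j'"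
        unfolding mod_eq_dvd_iff[symmetric] using pq by simp
      have i: "e dvd i - i' \<longleftrightarrow> i = i'"
        unfolding mod_eq_dvd_iff[symmetric] using pq by simp
      show ?thesis
        unfolding mem j using i by (cases "j = j'") auto
    qed
    ultimately show "p = q \<longleftrightarrow> (case p of (i, j) \<Rightarrow> of_int i * u + of_int j * v) -
        (case q of (i, j) \<Rightarrow> of_int i * u + of_int j * v) \<in> H"
      by (simp only:) simp
  qed
  then have idx: "subgroup_index L H = nat (e * g)"
    using e(1) g(1) by (simp add: nat_mult_distrib)
  have "real (subgroup_index L H) = of_int (e * g)"
    unfolding idx using e(1) g(1) by (subst of_nat_nat) auto
  then show ?thesis using cov_H by simp
qed


section \<open>Imaginary quadratic fields\<close>

text \<open>Take \<open>c\<close> to be the generator of the group of all common denominators. A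
  common factor of \<open>c\<close>, \<open>b\<close>, \<open>a\<close> could be cancelled, and the
  quotient of \<open>c\<close> would again be a common denominator, hence divisible by
  \<open>c\<close>. So the three numbers are coprime.\<close>

lemma common_denominator:
  fixes T N :: complex
  assumes "T \<in> \<rat>" "N \<in> \<rat>"
  obtains c b a x y z :: int
  where "c > 0" "of_int c * T = of_int b" "of_int c * N = of_int a"
    "x * c + y * b + z * a = 1"
    "\<And>k. of_int k * T \<in> \<int> \<and> of_int k * N \<in> \<int> \<longleftrightarrow> c dvd k"
proof -
  obtain i j where ij: "j > 0" "T = of_int i / of_int j" by (rule Rats_cases'[OF assms(1)])
  obtain i' j' where ij': "j' > 0" "N = of_int i' / of_int j'" by (rule Rats_cases'[OF assms(2)])
  let ?S = "{k::int. of_int k * T \<in> \<int> \<and> of_int k * N \<in> \<int>}"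
  have "\<exists>c>0. ?S = {x. c dvd x}"
  proof (rule int_subgroup_generator)
    have "of_int (j * j') * T = of_int (j' * i)" "of_int (j * j') * N = of_int (j * i')"
      using ij ij' by auto
    then show "j * j' \<in> ?S" by (metis (mono_tags, lifting) Ints_of_int mem_Collect_eq)
    show "j * j' > 0" using ij ij' by simp
    fix k l assume "k \<in> ?S" "l \<in> ?S"
    then show "k - l \<in> ?S" by (simp add: left_diff_distrib)
  qed
  then obtain c where c: "c > 0" "\<And>k. of_int k * T \<in> \<int> \<and> of_int k * N \<in> \<int> \<longleftrightarrow> c dvd k"
    by blast
  then obtain b a where ab: "of_int c * T = of_int b" "of_int c * N = of_int a"
    by (meson Ints_cases dvd_refl)
  let ?h = "gcd b a" let ?g = "gcd c ?h"
  obtain c1 where c1: "c = ?g * c1" by (meson dvdE gcd_dvd1)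
  obtain b1 where b1: "b = ?g * b1" by (meson dvdE gcd_dvd1 gcd_dvd2 dvd_trans)
  obtain a1 where a1: "a = ?g * a1" by (meson dvdE gcd_dvd2 dvd_trans)
  have g0: "(of_int ?g :: complex) \<noteq> 0" using c(1) by simp
  have "of_int c1 * T = of_int b1"
  proof -
    have "of_int ?g * (of_int c1 * T) = of_int ?g * of_int b1"
      using ab(1) by (metis b1 c1 mult.assoc of_int_mult)
    then show ?thesis using mult_left_cancel[OF g0] by blast
  qed
  moreover have "of_int c1 * N = of_int a1"
  proof -
    have "of_int ?g * (of_int c1 * N) = of_int ?g * of_int a1"
      using ab(2) by (metis a1 c1 mult.assoc of_int_mult)
    then show ?thesis using mult_left_cancel[OF g0] by blast
  qed
  ultimately have "c dvd c1" using c(2) by (metis Ints_of_int)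
  then have "?g * c1 dvd 1 * c1" using c1 by simp
  moreover have "c1 \<noteq> 0" using c(1) c1 by auto
  ultimately have "?g dvd 1" by (metis dvd_mult_cancel_right)
  then have "\<bar>?g\<bar> = 1" by (simp only: zdvd1_eq)
  then have g1: "?g = 1" using gcd_ge_0_int[of c ?h] by linarith
  obtain u v where uv: "u * c + v * ?h = ?g" using bezout_int by blast
  obtain p q where pq: "p * b + q * a = ?h" using bezout_int by blast
  have "u * c + (v * p) * b + (v * q) * a = 1"
    using uv g1 pq by (metis add.assoc distrib_left mult.assoc)
  then show ?thesis using that c ab by blast
qed

lemma poly_of_int_smult:
  "poly (map_poly of_int (Polynomial.smult a p)) z = of_int a * poly (map_poly of_int p) (z::complex)"
  by (induction p) (simp_all add: map_poly_pCons algebra_simps)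

lemma poly_of_int_add:
  "poly (map_poly of_int (p + q)) z = poly (map_poly of_int p) z + poly (map_poly of_int q) (z::complex)"
  by (induction p q rule: poly_induct2) (simp_all add: map_poly_pCons algebra_simps)

lemma poly_of_int_mult:
  "poly (map_poly of_int (p * q)) z = poly (map_poly of_int p) z * poly (map_poly of_int q) (z::complex)"
  by (induction p)
     (simp_all add: map_poly_pCons mult_pCons_left poly_of_int_add poly_of_int_smult algebra_simps)

text \<open>Gauss's lemma: the primitive integral multiple of the minimal polynomial divides a monic
  integral polynomial, so it is itself monic.\<close>

lemma algebraic_int_trace_norm:
  fixes z :: complex
  assumes "algebraic_int z" "z \<notin> \<real>" "z + cnj z \<in> \<rat>" "z * cnj z \<in> \<rat>"
  shows "z + cnj z \<in> \<int>" "z * cnj z \<in> \<int>"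
proof -
  obtain c b a x y w :: int where c: "c > 0" "of_int c * (z + cnj z) = of_int b"
    "of_int c * (z * cnj z) = of_int a" "x * c + y * b + w * a = 1"
    by (rule common_denominator[OF assms(3,4)])
  define Q where "Q = [:a, - b, c:]"
  obtain p :: "int poly" where p: "poly (map_poly of_int p) z = 0" "lead_coeff p = 1"
    using assms(1) unfolding algebraic_int_altdef_ipoly by blast
  have "Q \<noteq> 0" "degree Q = 2" using c(1) by (auto simp: Q_def)
  \<comment> \<open>Pseudo-division keeps the coefficients integral while \<open>Q\<close> is not
    yet known to be monic.\<close>
  obtain k q where kq: "k \<noteq> 0" "Polynomial.smult k p = Q * q + pseudo_mod p Q"
    using pseudo_mod(1)[OF \<open>Q \<noteq> 0\<close>] by blast
  define r where "r = pseudo_mod p Q"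
  have r: "r = 0 \<or> degree r < 2"
    using pseudo_mod(2)[OF \<open>Q \<noteq> 0\<close>] \<open>degree Q = 2\<close> by (simp add: r_def)
  have Qz: "poly (map_poly of_int Q) z = 0"
  proof -
    have "poly (map_poly of_int Q) z = of_int a - of_int b * z + of_int c * z * z"
      by (simp add: Q_def map_poly_pCons algebra_simps)
    also have "\<dots> = 0" unfolding c(2)[symmetric] c(3)[symmetric] by (simp add: algebra_simps)
    finally show ?thesis .
  qed
  have "poly (map_poly of_int (Polynomial.smult k p)) z = poly (map_poly of_int (Q * q + r)) z"
    using kq r_def by simp
  then have rz: "poly (map_poly of_int r) z = 0"
    using p(1) Qz by (simp add: poly_of_int_add poly_of_int_mult poly_of_int_smult)
  obtain r0 r1 where r01: "r = [:r0, r1:]"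
  proof
    have "degree r \<le> 1" using r by (cases "r = 0") auto
    then show "r = [:Polynomial.coeff r 0, Polynomial.coeff r 1:]"
      by (intro poly_eqI) (auto simp: coeff_pCons coeff_eq_0 split: nat.splits)
  qed
  have "of_int r0 + z * of_int r1 = 0" using rz by (simp add: r01 map_poly_pCons)
  \<comment> \<open>A nonzero linear remainder would make its root \<open>z\<close> real.\<close>
  have "r1 = 0"
  proof (rule ccontr)
    assume "r1 \<noteq> 0"
    then have "z = - of_int r0 / of_int r1"
      using \<open>of_int r0 + z * of_int r1 = 0\<close> by (simp add: field_simps eq_neg_iff_add_eq_0)
    also have "\<dots> \<in> \<real>" by simp
    finally show False using assms(2) by simp
  qed
  then have "r = 0" using \<open>of_int r0 + z * of_int r1 = 0\<close> r01 by simp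
  then have eq: "Polynomial.smult k p = Q * q" using kq r_def by simp
  have "content p dvd 1" using content_dvd_coeff[of p "degree p"] p(2) by simp
  then have cp: "content p = 1" by (metis is_unit_normalize normalize_content)
  have "content Q dvd c" "content Q dvd b" "content Q dvd a"
    using content_dvd_coeff[of Q 2] content_dvd_coeff[of Q 1] content_dvd_coeff[of Q 0]
    by (simp_all add: Q_def numeral_2_eq_2)
  then have "content Q dvd x * c + y * b + w * a" by (intro dvd_add dvd_mult)
  then have "content Q dvd 1" using c(4) by simp
  then have cQ: "content Q = 1" by (metis is_unit_normalize normalize_content)
  \<comment> \<open>Since \<open>p\<close> and \<open>Q\<close> are primitive, \<open>q\<close>
    absorbs all of \<open>k\<close>. Comparing leading coefficients after cancelling it shows that
    \<open>c\<close> divides 1.\<close>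
  have "content q = \<bar>k\<bar>"
    using arg_cong[OF eq, of content] cp cQ by (simp add: content_mult)
  then obtain q' where q': "q = Polynomial.smult \<bar>k\<bar> q'" by (metis content_times_primitive_part)
  have "k = lead_coeff (Polynomial.smult k p)" using p(2) by simp
  also have "\<dots> = c * (\<bar>k\<bar> * lead_coeff q')"
    unfolding eq lead_coeff_mult q' using c(1) by (simp add: Q_def)
  finally have "\<bar>k\<bar> * (c * lead_coeff q') = k" by (simp add: mult_ac)
  then have "\<bar>c * lead_coeff q'\<bar> = 1" using kq(1) by (metis abs_abs abs_mult mult_cancel_left2 abs_eq_0)
  then have "c = 1" using c(1) by (simp add: abs_mult zmult_eq_1_iff)
  then show "z + cnj z \<in> \<int>" "z * cnj z \<in> \<int>" using c(2,3) by auto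
qed

text \<open>\<open>s\<close> is a root of the monic integral quadratic with roots \<open>s\<close>
  and \<open>t\<close>, and a rational algebraic integer is an integer. Taking
  \<open>t = - s\<close> treats a rational number with integral square.\<close>

lemma Ints_if_sum_product_Ints:
  fixes s t :: complex
  assumes "s \<in> \<rat>" "s + t \<in> \<int>" "s * t \<in> \<int>"
  shows "s \<in> \<int>"
proof (rule rational_algebraic_int_is_int[OF _ assms(1)])
  show "algebraic_int s"
  proof (rule algebraic_int.intros)
    show "poly [:s * t, - (s + t), 1:] s = 0" by (simp add: algebra_simps)
    show "lead_coeff [:s * t, - (s + t), 1:] = 1" by simp
    show "\<forall>i. Polynomial.coeff [:s * t, - (s + t), 1:] i \<in> \<int>"
      using assms Ints_minus[OF assms(2)] by (simp add: coeff_pCons split: nat.split)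
  qed
qed

section \<open>A rational basis of the field\<close>

text \<open>The rewrites let the elimination rules for \<open>dimension\<close> and
  \<open>line_extension\<close> speak of ordinary complex sums and products.\<close>

interpretation complex_field: cring complex_field
  rewrites "carrier complex_field = UNIV" and "x \<otimes>\<^bsub>complex_field\<^esub> y = x * y"
    and "x \<oplus>\<^bsub>complex_field\<^esub> y = x + y" and "\<zero>\<^bsub>complex_field\<^esub> = 0" and "\<one>\<^bsub>complex_field\<^esub> = 1"
proof -
  show "cring complex_field"
  proof (rule cringI)
    show "abelian_group complex_field"
    proof (rule abelian_groupI)
      fix x assume "x \<in> carrier complex_field"
      show "\<exists>y\<in>carrier complex_field. y \<oplus>\<^bsub>complex_field\<^esub> x = \<zero>\<^bsub>complex_field\<^esub>"
        by (rule bexI[of _ "- x"]) (simp_all add: complex_field_def)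
    qed (simp_all add: complex_field_def)
    show "comm_monoid complex_field"
      by (rule comm_monoidI) (simp_all add: complex_field_def)
  qed (simp add: complex_field_def distrib_right)
qed (simp_all add: complex_field_def)

lemma imaginary_quadratic_field_mult:
  assumes "imaginary_quadratic_field K"
  shows "1 \<in> K" "x \<in> K \<Longrightarrow> y \<in> K \<Longrightarrow> x * y \<in> K"
proof -
  have "subring K complex_field"
    using assms subfieldE(1) by (auto simp: imaginary_quadratic_field_def)
  from subringE(3,6)[OF this] show "1 \<in> K" "x \<in> K \<Longrightarrow> y \<in> K \<Longrightarrow> x * y \<in> K"
    by (simp_all add: complex_field_def)
qed

lemma imaginary_quadratic_field_span:
  assumes "imaginary_quadratic_field K"
  obtains v w where "K = {p * v + q * w |p q. p \<in> \<rat> \<and> q \<in> \<rat>}"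
proof -
  have "complex_field.dimension (Suc (Suc 0)) \<rat> K"
    using assms by (simp add: imaginary_quadratic_field_def numeral_2_eq_2)
  then obtain v E where vE: "K = complex_field.line_extension \<rat> v E" "complex_field.dimension (Suc 0) \<rat> E"
    by (cases rule: complex_field.dimension.cases) auto
  from vE(2) obtain w E' where wE: "E = complex_field.line_extension \<rat> w E'" "complex_field.dimension 0 \<rat> E'"
    by (cases rule: complex_field.dimension.cases) auto
  from wE(2) have "E' = {0}" by (cases rule: complex_field.dimension.cases) auto
  then have E: "E = (\<lambda>q. q * w) ` \<rat>"
    unfolding wE by (auto simp: complex_field.line_extension_mem_iff)
  then have "x \<in> K \<longleftrightarrow> (\<exists>p\<in>\<rat>. \<exists>q\<in>\<rat>. x = p * v + q * w)" for x
    unfolding vE complex_field.line_extension_mem_iff E by simp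
  then have "K = {p * v + q * w |p q. p \<in> \<rat> \<and> q \<in> \<rat>}" by blast
  then show ?thesis by (rule that)
qed

text \<open>A nonreal \<omega> of the field is independent of 1 over the rationals. Completing the
  square in its quadratic equation and clearing the denominator turns it into a purely imaginary
  \<open>s\<close> with an integral square.\<close>

lemma imaginary_quadratic_field_basis:
  assumes K: "imaginary_quadratic_field K"
  obtains s :: complex and e :: int
  where "e > 0" "s\<^sup>2 = - of_int e" "cnj s = - s" "K = {p + q * s |p q. p \<in> \<rat> \<and> q \<in> \<rat>}"
proof -
  obtain v w where Kvw: "K = {p * v + q * w |p q. p \<in> \<rat> \<and> q \<in> \<rat>}"
    by (rule imaginary_quadratic_field_span[OF K])
  obtain \<omega> where \<omega>: "\<omega> \<in> K" "\<omega> \<notin> \<real>"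
    using K by (auto simp: imaginary_quadratic_field_def)
  obtain a b where ab: "a \<in> \<rat>" "b \<in> \<rat>" "1 = a * v + b * w"
    using imaginary_quadratic_field_mult(1)[OF K] unfolding Kvw by blast
  obtain c d where cd: "c \<in> \<rat>" "d \<in> \<rat>" "\<omega> = c * v + d * w"
    using \<omega>(1) unfolding Kvw by blast
  \<comment> \<open>Cramer's rule expresses the given spanning vectors \<open>v\<close>,
    \<open>w\<close> through 1 and \<omega>.\<close>
  define det where "det = a * d - b * c"
  have v: "d - b * \<omega> = det * v" and w: "a * \<omega> - c = det * w"
  proof -
    have "d * 1 - b * \<omega> = det * v" "a * \<omega> - c * 1 = det * w"
      unfolding ab(3) cd(3) det_def by (simp_all add: algebra_simps)
    then show "d - b * \<omega> = det * v" "a * \<omega> - c = det * w" by simp_all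
  qed
  have Rats_Reals: "x \<in> \<real>" if "x \<in> \<rat>" for x :: complex
    using that by (elim Rats_cases') simp
  have indep: "q = 0" if "p \<in> \<rat>" "q \<in> \<rat>" "p + q * \<omega> = 0" for p q
  proof (rule ccontr)
    assume "q \<noteq> 0"
    then have "\<omega> = - p / q" using that(3) by (simp add: field_simps eq_neg_iff_add_eq_0)
    moreover have "- p / q \<in> \<real>" using that Rats_Reals by (intro Reals_divide Reals_minus) auto
    ultimately show False using \<omega> by simp
  qed
  have "det \<noteq> 0"
  proof
    assume "det = 0"
    then have "d + (- b) * \<omega> = 0" "- c + a * \<omega> = 0" using v w by simp_all
    then have "- b = 0" "a = 0" using indep[of d "- b"] indep[of "- c" a] ab cd by auto
    then show False using ab(3) by simp
  qed
  have det: "det \<in> \<rat>" unfolding det_def using ab cd by simp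
  have K1: "K = {p + q * \<omega> |p q. p \<in> \<rat> \<and> q \<in> \<rat>}"
  proof (intro equalityI subsetI)
    fix z assume "z \<in> K"
    then obtain p q where pq: "p \<in> \<rat>" "q \<in> \<rat>" "z = p * v + q * w" unfolding Kvw by blast
    have "v = (d - b * \<omega>) / det" "w = (a * \<omega> - c) / det" using v w \<open>det \<noteq> 0\<close> by (simp_all add: field_simps)
    then have "z = p * ((d - b * \<omega>) / det) + q * ((a * \<omega> - c) / det)"
      unfolding pq(3) by simp
    also have "\<dots> = (p * d - q * c) / det + (q * a - p * b) / det * \<omega>"
      by (simp add: add_divide_distrib diff_divide_distrib algebra_simps)
    finally have "z = (p * d - q * c) / det + (q * a - p * b) / det * \<omega>" .
    moreover have "(p * d - q * c) / det \<in> \<rat>" "(q * a - p * b) / det \<in> \<rat>"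
      using pq ab cd det by simp_all
    ultimately show "z \<in> {p + q * \<omega> |p q. p \<in> \<rat> \<and> q \<in> \<rat>}" by blast
  next
    fix z assume "z \<in> {p + q * \<omega> |p q. p \<in> \<rat> \<and> q \<in> \<rat>}"
    then obtain p q where pq: "p \<in> \<rat>" "q \<in> \<rat>" "z = p * 1 + q * \<omega>" by auto
    then have "z = (p * a + q * c) * v + (p * b + q * d) * w"
      unfolding pq(3) ab(3) cd(3) by (simp add: algebra_simps)
    moreover have "p * a + q * c \<in> \<rat>" "p * b + q * d \<in> \<rat>" using pq ab cd by simp_all
    ultimately show "z \<in> K" unfolding Kvw by blast
  qed
  have "\<omega> * \<omega> \<in> K" using imaginary_quadratic_field_mult(2)[OF K \<omega>(1) \<omega>(1)] .
  then obtain A B where AB: "A \<in> \<rat>" "B \<in> \<rat>" "\<omega> * \<omega> = A + B * \<omega>" unfolding K1 by blast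
  define s0 where "s0 = 2 * \<omega> - B"
  have s0_sq: "s0\<^sup>2 = 4 * A + B\<^sup>2"
  proof -
    have "s0\<^sup>2 = 4 * (\<omega> * \<omega>) - 4 * B * \<omega> + B\<^sup>2"
      by (simp add: s0_def power2_eq_square algebra_simps)
    then show ?thesis unfolding AB(3) by (simp add: algebra_simps)
  qed
  then have "s0\<^sup>2 \<in> \<rat>" using AB by simp
  obtain m n where mn: "n > 0" "s0\<^sup>2 = of_int m / of_int n" by (rule Rats_cases'[OF \<open>s0\<^sup>2 \<in> \<rat>\<close>])
  have "Im s0 \<noteq> 0"
  proof
    assume "Im s0 = 0"
    then have "s0 \<in> \<real>" by (simp add: complex_is_Real_iff)
    then have "(s0 + B) / 2 \<in> \<real>"
      using Rats_Reals[OF AB(2)] by (intro Reals_divide Reals_add) auto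
    then show False using \<omega> by (simp add: s0_def)
  qed
  moreover have "Im (s0\<^sup>2) = 0"
    using Rats_Reals[OF \<open>s0\<^sup>2 \<in> \<rat>\<close>] by (simp add: complex_is_Real_iff)
  ultimately have "Re s0 = 0" by (simp add: power2_eq_square)
  \<comment> \<open>Multiplying by the whole denominator \<open>n\<close> turns the square
    \<open>m / n\<close> into the integer \<open>m * n\<close>.\<close>
  define s where "s = of_int n * s0"
  have s2: "s\<^sup>2 = of_int (m * n)"
    using mn by (simp add: s_def power_mult_distrib field_simps power2_eq_square)
  have "Re s = 0" "Im s \<noteq> 0" using \<open>Re s0 = 0\<close> \<open>Im s0 \<noteq> 0\<close> mn by (simp_all add: s_def)
  then have cnj_s: "cnj s = - s" by (simp add: complex_eq_iff)
  have "Re (s\<^sup>2) < 0" using \<open>Re s = 0\<close> \<open>Im s \<noteq> 0\<close> by (simp add: power2_eq_square flip: not_le) (simp add: mult_le_0_iff)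
  then have "m * n < 0" unfolding s2 by (simp del: of_int_mult)
  have K2: "K = {p + q * s |p q. p \<in> \<rat> \<and> q \<in> \<rat>}"
  proof (intro equalityI subsetI)
    fix z assume "z \<in> K"
    then obtain p q where pq: "p \<in> \<rat>" "q \<in> \<rat>" "z = p + q * \<omega>" unfolding K1 by blast
    have "\<omega> = s / (2 * of_int n) + B / 2" using mn(1) by (simp add: s_def s0_def field_simps)
    then have "z = (p + q * B / 2) + (q / (2 * of_int n)) * s"
      unfolding pq(3) by (simp add: algebra_simps)
    moreover have "p + q * B / 2 \<in> \<rat>" "q / (2 * of_int n) \<in> \<rat>" using pq AB by simp_all
    ultimately show "z \<in> {p + q * s |p q. p \<in> \<rat> \<and> q \<in> \<rat>}" by blast
  next
    fix z assume "z \<in> {p + q * s |p q. p \<in> \<rat> \<and> q \<in> \<rat>}"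
    then obtain p q where pq: "p \<in> \<rat>" "q \<in> \<rat>" "z = p + q * s" by auto
    then have "z = (p - q * of_int n * B) + (q * of_int n * 2) * \<omega>"
      by (simp add: s_def s0_def algebra_simps)
    moreover have "p - q * of_int n * B \<in> \<rat>" "q * of_int n * 2 \<in> \<rat>" using pq AB by simp_all
    ultimately show "z \<in> K" unfolding K1 by blast
  qed
  show ?thesis
    by (rule that[of "- (m * n)" s]) (use \<open>m * n < 0\<close> s2 cnj_s K2 in auto)
qed

section \<open>Arithmetic of the ring of integers\<close>

locale imaginary_quadratic =
  fixes K :: "complex set"
  assumes field: "imaginary_quadratic_field K"
begin

abbreviation \<O> :: "complex set" where "\<O> \<equiv> integers_of K"

text \<open>In the coordinates \<open>p + q * s\<close> conjugation negates \<open>q\<close>, the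
  trace is \<open>2 * p\<close>, and the norm is a rational quadratic form in \<open>p\<close> and
  \<open>q\<close>.\<close>

lemma K_add: "x \<in> K \<Longrightarrow> y \<in> K \<Longrightarrow> x + y \<in> K"
  and K_minus: "x \<in> K \<Longrightarrow> - x \<in> K"
  and K_cnj: "x \<in> K \<Longrightarrow> cnj x \<in> K"
  and K_Rats: "r \<in> \<rat> \<Longrightarrow> r \<in> K"
  and K_trace: "x \<in> K \<Longrightarrow> x + cnj x \<in> \<rat>"
  and K_norm: "x \<in> K \<Longrightarrow> x * cnj x \<in> \<rat>"
  and K_real: "x \<in> K \<Longrightarrow> x \<in> \<real> \<Longrightarrow> x \<in> \<rat>"
proof -
  obtain s :: complex and e :: int where s: "e > 0" "s\<^sup>2 = - of_int e" "cnj s = - s"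
    and K: "K = {p + q * s |p q. p \<in> \<rat> \<and> q \<in> \<rat>}"
    by (rule imaginary_quadratic_field_basis[OF field])
  have KI: "p + q * s \<in> K" if "p \<in> \<rat>" "q \<in> \<rat>" for p q unfolding K using that by blast
  have Q: "cnj r = r" if "r \<in> \<rat>" for r
    using that by (elim Rats_cases') simp
  show "x + y \<in> K" if "x \<in> K" "y \<in> K"
  proof -
    from that obtain p q p' q' where pq: "p \<in> \<rat>" "q \<in> \<rat>" "p' \<in> \<rat>" "q' \<in> \<rat>" "x = p + q * s" "y = p' + q' * s"
      unfolding K by blast
    then have "x + y = (p + p') + (q + q') * s" by (simp add: algebra_simps)
    also have "\<dots> \<in> K" using pq by (intro KI) simp_all
    finally show ?thesis .
  qed
  show "r \<in> K" if "r \<in> \<rat>" using KI[of r 0] that by simp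
  show "- x \<in> K" "cnj x \<in> K" "x + cnj x \<in> \<rat>" "x * cnj x \<in> \<rat>" "x \<in> \<real> \<Longrightarrow> x \<in> \<rat>" if "x \<in> K"
  proof -
    from that obtain p q where pq: "p \<in> \<rat>" "q \<in> \<rat>" "x = p + q * s" unfolding K by blast
    have "- x = (- p) + (- q) * s" "cnj x = p + (- q) * s"
      using pq s Q by simp_all
    then show "- x \<in> K" "cnj x \<in> K" using KI[of "- p" "- q"] KI[of p "- q"] pq by simp_all
    have "x + cnj x = 2 * p" using pq s Q by simp
    then show "x + cnj x \<in> \<rat>" by (simp only:) (use pq in simp)
    have "x * cnj x = p * p - q * q * s\<^sup>2"
      using pq s(3) Q by (simp add: algebra_simps power2_eq_square)
    then show "x * cnj x \<in> \<rat>" using pq s(2) by simp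
    assume "x \<in> \<real>"
    then have "q * s = 0"
      using pq s Q Reals_cnj_iff[of x] by (simp add: Reals_cnj_iff)
    then have "x = p" using pq(3) by simp
    then show "x \<in> \<rat>" using pq(1) by simp
  qed
qed

lemma K_mult: "x \<in> K \<Longrightarrow> y \<in> K \<Longrightarrow> x * y \<in> K"
  by (rule imaginary_quadratic_field_mult(2)[OF field])

lemma K_inverse: "x \<in> K \<Longrightarrow> inverse x \<in> K"
proof (cases "x = 0")
  case False
  assume "x \<in> K"
  then have "inverse (x * cnj x) * cnj x \<in> K"
    by (intro K_mult K_cnj K_Rats[OF Rats_inverse[OF K_norm]])
  then show ?thesis using False by (simp add: field_simps)
qed simp

lemma K_divide: "x \<in> K \<Longrightarrow> y \<in> K \<Longrightarrow> x / y \<in> K"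
  by (simp add: divide_inverse K_mult K_inverse)

text \<open>A real element of the field is rational, and for a nonreal one Gauss's lemma applies.
  Conversely, trace and norm are the coefficients of a monic quadratic with root \<open>x\<close>.
  The closure properties of \<open>\<O>\<close> are derived from this criterion.\<close>

lemma integers_iff: "x \<in> \<O> \<longleftrightarrow> x \<in> K \<and> x + cnj x \<in> \<int> \<and> x * cnj x \<in> \<int>"
proof (intro iffI conjI)
  assume "x \<in> \<O>"
  then have x: "x \<in> K" "algebraic_int x" by (auto simp: integers_of_def)
  then show "x \<in> K" by simp
  have "x + cnj x \<in> \<int> \<and> x * cnj x \<in> \<int>"
  proof (cases "x \<in> \<real>")
    case True
    then have "x \<in> \<int>" using K_real x rational_algebraic_int_is_int by blast
    then show ?thesis by (auto elim!: Ints_cases)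
  next
    case False
    then show ?thesis using algebraic_int_trace_norm x K_trace K_norm by blast
  qed
  then show "x + cnj x \<in> \<int>" "x * cnj x \<in> \<int>" by auto
next
  assume x: "x \<in> K \<and> x + cnj x \<in> \<int> \<and> x * cnj x \<in> \<int>"
  have "algebraic_int x"
  proof (rule algebraic_int.intros)
    show "poly [:x * cnj x, - (x + cnj x), 1:] x = 0" by (simp add: algebra_simps)
    show "lead_coeff [:x * cnj x, - (x + cnj x), 1:] = 1" by simp
    show "\<forall>i. Polynomial.coeff [:x * cnj x, - (x + cnj x), 1:] i \<in> \<int>"
      using x Ints_minus[of "x + cnj x"] by (simp add: coeff_pCons split: nat.split)
  qed
  then show "x \<in> \<O>" using x by (simp add: integers_of_def)
qed

lemma O_subset_K: "x \<in> \<O> \<Longrightarrow> x \<in> K"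
  by (simp add: integers_iff)

text \<open>Both numbers are rational, and their sum and product are integers, although neither is yet known
  to be the trace of an integer.\<close>

lemma O_cross_trace:
  assumes "x \<in> \<O>" "y \<in> \<O>"
  shows "x * y + cnj (x * y) \<in> \<int>" "x * cnj y + cnj x * y \<in> \<int>"
proof -
  define s where "s = x * y + cnj (x * y)"
  define t where "t = x * cnj y + cnj x * y"
  have x: "x \<in> K" "x + cnj x \<in> \<int>" "x * cnj x \<in> \<int>" and y: "y \<in> K" "y + cnj y \<in> \<int>" "y * cnj y \<in> \<int>"
    using assms by (auto simp: integers_iff)
  have "s + t = (x + cnj x) * (y + cnj y)" by (simp add: s_def t_def algebra_simps)
  then have sum: "s + t \<in> \<int>" using x y by simp
  have "s * t = (y * cnj y) * ((x + cnj x) * (x + cnj x) - 2 * (x * cnj x))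
      + (x * cnj x) * ((y + cnj y) * (y + cnj y) - 2 * (y * cnj y))"
    by (simp add: s_def t_def algebra_simps)
  then have prod: "s * t \<in> \<int>"
    using x(2,3) y(2,3) Ints_add Ints_diff Ints_mult Ints_numeral by metis
  have "s \<in> \<rat>" unfolding s_def using K_trace K_mult x y by blast
  then show "s \<in> \<int>" using sum prod by (rule Ints_if_sum_product_Ints)
  then have "(s + t) - s \<in> \<int>" using sum by (rule Ints_diff[rotated])
  then show "t \<in> \<int>" by simp
qed

lemma O_mult: "x \<in> \<O> \<Longrightarrow> y \<in> \<O> \<Longrightarrow> x * y \<in> \<O>"
proof -
  assume xy: "x \<in> \<O>" "y \<in> \<O>"
  have "(x * y) * cnj (x * y) = (x * cnj x) * (y * cnj y)" by simp
  also have "\<dots> \<in> \<int>" by (rule Ints_mult) (use xy in \<open>simp_all add: integers_iff\<close>)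
  finally show ?thesis
    using O_cross_trace(1)[OF xy] xy by (simp add: integers_iff K_mult)
qed

lemma O_add: "x \<in> \<O> \<Longrightarrow> y \<in> \<O> \<Longrightarrow> x + y \<in> \<O>"
proof -
  assume xy: "x \<in> \<O>" "y \<in> \<O>"
  have "(x + y) + cnj (x + y) = (x + cnj x) + (y + cnj y)" by simp
  also have "\<dots> \<in> \<int>" by (rule Ints_add) (use xy in \<open>simp_all add: integers_iff\<close>)
  finally have 1: "(x + y) + cnj (x + y) \<in> \<int>" .
  have "(x + y) * cnj (x + y) = x * cnj x + y * cnj y + (x * cnj y + cnj x * y)"
    by (simp add: algebra_simps)
  also have "\<dots> \<in> \<int>"
    by (rule Ints_add[OF Ints_add]) (use xy O_cross_trace(2)[OF xy] in \<open>simp_all add: integers_iff\<close>)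
  finally show ?thesis using 1 xy by (simp add: integers_iff K_add)
qed

lemma O_cnj: "x \<in> \<O> \<Longrightarrow> cnj x \<in> \<O>"
  by (simp add: integers_iff K_cnj add.commute mult.commute)

lemma O_minus: "x \<in> \<O> \<Longrightarrow> - x \<in> \<O>"
  unfolding integers_iff using K_minus Ints_minus[of "x + cnj x"] by simp

lemma O_diff: "x \<in> \<O> \<Longrightarrow> y \<in> \<O> \<Longrightarrow> x - y \<in> \<O>"
  using O_add[of x "- y"] O_minus[of y] by simp

lemma O_Ints: "n \<in> \<int> \<Longrightarrow> n \<in> \<O>"
  by (auto elim!: Ints_cases simp: integers_iff K_Rats)

lemma O_of_int: "of_int n \<in> \<O>" and O_zero: "0 \<in> \<O>" and O_one: "1 \<in> \<O>"
  by (simp_all add: O_Ints)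

lemmas O_closed = O_add O_diff O_minus O_mult O_cnj O_of_int O_zero O_one

lemma add_subgroup_O: "add_subgroup \<O>"
  by (simp add: add_subgroup_def O_zero O_diff)

lemma integral_multiple:
  assumes "x \<in> K"
  obtains k :: int where "k > 0" "of_int k * x \<in> \<O>"
proof -
  obtain c b a p q r :: int where c: "c > 0" "of_int c * (x + cnj x) = of_int b"
    "of_int c * (x * cnj x) = of_int a" "p * c + q * b + r * a = 1"
    by (rule common_denominator[OF K_trace[OF assms] K_norm[OF assms]])
  have "of_int c * x + cnj (of_int c * x) = of_int c * (x + cnj x)"
    "(of_int c * x) * cnj (of_int c * x) = of_int c * (of_int c * (x * cnj x))"
    by (simp_all add: algebra_simps)
  then have "of_int c * x + cnj (of_int c * x) \<in> \<int>" "(of_int c * x) * cnj (of_int c * x) \<in> \<int>"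
    unfolding c(2,3) by (metis Ints_of_int of_int_mult)+
  then have "of_int c * x \<in> \<O>"
    unfolding integers_iff using assms K_mult K_Rats by simp
  then show ?thesis using that c(1) by blast
qed

text \<open>Sandwich: the lattice spanned by 1 and \<open>s\<close> lies in \<open>\<O>\<close> and
  contains \<open>2 * e\<close> times \<open>\<O>\<close>. The latter multiple is thus a sublattice
  of finite index, and scaling it back gives \<open>\<O>\<close>.\<close>

lemma O_covolume: "\<exists>c. has_covolume \<O> c"
proof -
  obtain s :: complex and e :: int where s: "e > 0" "s\<^sup>2 = - of_int e" "cnj s = - s"
    and K: "K = {p + q * s |p q. p \<in> \<rat> \<and> q \<in> \<rat>}"
    by (rule imaginary_quadratic_field_basis[OF field])
  let ?M = "int_span 1 s" and ?m = "of_int (2 * e) :: complex"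
  have sK: "s \<in> K" unfolding K using Rats_0 Rats_1 by force
  have "s * cnj s = of_int e" using s by (simp add: power2_eq_square)
  then have sO: "s \<in> \<O>" using sK s by (simp add: integers_iff)
  have "Im s \<noteq> 0"
  proof
    assume "Im s = 0"
    moreover have "Re s = 0" using arg_cong[OF s(3), of Re] by simp
    ultimately have "s = 0" by (simp add: complex_eq_iff)
    then show False using s by simp
  qed
  then have M: "has_covolume ?M \<bar>Im s\<bar>"
    unfolding has_covolume_def by (intro exI[of _ 1] exI[of _ s]) simp
  have sub: "?m * x \<in> ?M" if "x \<in> \<O>" for x
  proof -
    have x: "x \<in> K" "x + cnj x \<in> \<int>" "x * cnj x \<in> \<int>" using that by (auto simp: integers_iff)
    obtain p q where pq: "p \<in> \<rat>" "q \<in> \<rat>" "x = p + q * s" using x(1) unfolding K by blast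
    have Q: "cnj r = r" if "r \<in> \<rat>" for r
      using that by (elim Rats_cases') simp
    have tr: "x + cnj x = 2 * p" using pq s Q by simp
    have "x * cnj x = p\<^sup>2 - q\<^sup>2 * s\<^sup>2"
      using pq s(3) Q by (simp add: algebra_simps power2_eq_square)
    then have nm: "x * cnj x = p\<^sup>2 + q\<^sup>2 * of_int e" using s(2) by simp
    \<comment> \<open>Four times the norm minus the squared trace is \<open>4 * e\<close> times the
      square of \<open>q\<close>. The extra factor \<open>e\<close> makes this a perfect
      square.\<close>
    have "(2 * of_int e * q)\<^sup>2 = of_int e * (4 * (x * cnj x) - (x + cnj x)\<^sup>2)"
      unfolding tr nm by (simp add: power_mult_distrib algebra_simps power2_eq_square)
    also have "\<dots> \<in> \<int>" using x(2,3) Ints_diff Ints_mult Ints_numeral Ints_of_int Ints_power by metis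
    finally have sq: "(2 * of_int e * q)\<^sup>2 \<in> \<int>" .
    have "2 * of_int e * q \<in> \<int>"
    proof (rule Ints_if_sum_product_Ints)
      show "2 * of_int e * q \<in> \<rat>" using pq by simp
      show "2 * of_int e * q + - (2 * of_int e * q) \<in> \<int>" by simp
      show "2 * of_int e * q * - (2 * of_int e * q) \<in> \<int>"
        using Ints_minus[OF sq] by (simp add: power2_eq_square)
    qed
    then obtain b where b: "2 * of_int e * q = of_int b" by (auto elim: Ints_cases)
    obtain a where a: "2 * p = of_int a" using x(2) unfolding tr by (auto elim: Ints_cases)
    have "?m * x = of_int e * (2 * p) + (2 * of_int e * q) * s" by (simp add: pq(3) algebra_simps)
    then show ?thesis unfolding a b by (intro int_spanI[of _ "e * a" _ b]) simp
  qed
  let ?H = "?m *o \<O>"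
  have "has_covolume ?H (real (subgroup_index ?M ?H) * \<bar>Im s\<bar>)"
  proof (rule has_covolume_subgroup[OF M, where k = "2 * e"])
    show "add_subgroup ?H"
      unfolding add_subgroup_def elt_set_times_def
    proof (intro conjI ballI)
      show "0 \<in> {c. \<exists>b\<in>\<O>. c = ?m * b}" using O_zero by force
      fix x y assume "x \<in> {c. \<exists>b\<in>\<O>. c = ?m * b}" "y \<in> {c. \<exists>b\<in>\<O>. c = ?m * b}"
      then obtain u v where "u \<in> \<O>" "v \<in> \<O>" "x - y = ?m * (u - v)" by (auto simp: algebra_simps)
      then show "x - y \<in> {c. \<exists>b\<in>\<O>. c = ?m * b}" using O_diff by blast
    qed
    show "?H \<subseteq> ?M" using sub by (auto simp: elt_set_times_def)
    show "2 * e > 0" using s by simp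
    fix x assume "x \<in> ?M"
    then have "x \<in> \<O>" using sO by (auto simp: int_span_def intro!: O_closed)
    then show "?m * x \<in> ?H" by blast
  qed
  then have "has_covolume (inverse ?m *o ?H) ((cmod (inverse ?m))\<^sup>2 * (real (subgroup_index ?M ?H) * \<bar>Im s\<bar>))"
    using s(1) by (intro has_covolume_scale) auto
  moreover have "inverse ?m *o ?H = \<O>" using s(1) by (simp add: set_times_rearrange2)
  ultimately show ?thesis by auto
qed

section \<open>The discriminant and the unimodular form\<close>

text \<open>The definite description is legitimate because the squared determinant is -4 times the
  squared covolume, hence independent of the basis. Exchanging the basis vectors, if necessary,
  adjusts the orientation to the chosen root.\<close>

lemma discriminant_basis:
  obtains u v where "\<O> = int_span u v" "u * cnj v - v * cnj u = sqrt_disc K" "sqrt_disc K \<noteq> 0"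
proof -
  obtain c where c: "has_covolume \<O> c" using O_covolume by blast
  then obtain u v where uv: "\<O> = int_span u v" "c = \<bar>Im (u * cnj v)\<bar>" "c > 0"
    by (auto simp: has_covolume_def)
  have cross: "x * cnj y - y * cnj x = \<i> * of_real (2 * Im (x * cnj y))" for x y
    by (simp add: complex_eq_iff)
  have cross_sq: "(x * cnj y - y * cnj x)\<^sup>2 = - of_real (4 * \<bar>Im (x * cnj y)\<bar>\<^sup>2)" for x y
  proof -
    have "(\<i> * of_real (2 * m))\<^sup>2 = - complex_of_real (4 * \<bar>m\<bar>\<^sup>2)" for m
      by (simp add: power_mult_distrib)
    then show ?thesis unfolding cross .
  qed
  have "u \<in> \<O>" "v \<in> \<O>"
    unfolding uv by (auto intro: int_spanI[of _ 1 _ 0] int_spanI[of _ 0 _ 1])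
  then have w: "u * cnj v \<in> \<O>" by (intro O_closed)
  have "(u * cnj v - v * cnj u)\<^sup>2 = ((u * cnj v) + cnj (u * cnj v))\<^sup>2 - 4 * ((u * cnj v) * cnj (u * cnj v))"
    by (simp add: power2_eq_square algebra_simps)
  also have "\<dots> \<in> \<int>"     using w[unfolded integers_iff] Ints_diff Ints_mult Ints_numeral Ints_power by metis
  finally obtain d where d: "(u * cnj v - v * cnj u)\<^sup>2 = of_int d" by (auto elim: Ints_cases)
  have "discriminant K = d"
    unfolding discriminant_def int_span_def[symmetric]
  proof (rule the_equality)
    show "\<exists>u v. \<O> = int_span u v \<and> of_int d = (u * cnj v - v * cnj u)\<^sup>2" using uv d by metis
    fix d' assume "\<exists>u v. \<O> = int_span u v \<and> of_int d' = (u * cnj v - v * cnj u)\<^sup>2"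
    then obtain u' v' where uv': "\<O> = int_span u' v'" "of_int d' = (u' * cnj v' - v' * cnj u')\<^sup>2" by blast
    \<comment> \<open>A spanning pair could a priori be degenerate; it is not, because it generates
      the independent pair \<open>u\<close>, \<open>v\<close>.\<close>
    have "Im (u' * cnj v') \<noteq> 0"
    proof
      assume 0: "Im (u' * cnj v') = 0"
      have "u \<in> int_span u' v'" "v \<in> int_span u' v'"
        using \<open>u \<in> \<O>\<close> \<open>v \<in> \<O>\<close> unfolding uv'(1) by auto
      then obtain a b p q where "u = of_int a * u' + of_int b * v'" "v = of_int p * u' + of_int q * v'"
        unfolding int_span_def by blast
      then have "Im (u * cnj v) = of_int (a * q - b * p) * Im (u' * cnj v')"
        by (simp only: Im_cross_combination)
      then show False using 0 uv by simp
    qed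
    then have "has_covolume \<O> \<bar>Im (u' * cnj v')\<bar>" using uv' unfolding has_covolume_def by auto
    then have "\<bar>Im (u' * cnj v')\<bar> = \<bar>Im (u * cnj v)\<bar>" using has_covolume_unique c uv by metis
    then have "(of_int d' :: complex) = of_int d"
      unfolding uv'(2) d[symmetric] cross_sq by simp
    then show "d' = d" by simp
  qed
  have "(of_int d :: complex) = - of_real (4 * \<bar>Im (u * cnj v)\<bar>\<^sup>2)" using d cross_sq by simp
  then have "of_real (of_int d) = (of_real (- (4 * c\<^sup>2)) :: complex)" using uv by simp
  then have "real_of_int d = - (4 * c\<^sup>2)" by (simp only: of_real_eq_iff)
  then have "real_of_int \<bar>d\<bar> = (2 * c)\<^sup>2" by (simp add: power_mult_distrib)
  then have "sqrt (of_int \<bar>discriminant K\<bar>) = 2 * c"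
    using uv \<open>discriminant K = d\<close> by (simp only: real_sqrt_abs)
  then have sd: "sqrt_disc K = \<i> * of_real (2 * c)" by (simp add: sqrt_disc_def)
  then have "sqrt_disc K \<noteq> 0" using uv by simp
  show ?thesis
  proof (cases "Im (u * cnj v) > 0")
    case True
    then have "u * cnj v - v * cnj u = sqrt_disc K" unfolding sd cross uv by simp
    then show ?thesis using that uv \<open>sqrt_disc K \<noteq> 0\<close> by blast
  next
    case False
    then have c': "c = - Im (u * cnj v)" using uv by (simp only: abs_of_nonpos not_less)
    have "v * cnj u - u * cnj v = - (u * cnj v - v * cnj u)" by simp
    also have "\<dots> = sqrt_disc K"
      unfolding sd cross c' by (simp only: mult_minus_right of_real_minus)
    finally have "v * cnj u - u * cnj v = sqrt_disc K" .
    moreover have "\<O> = int_span v u" unfolding uv int_span_def by (auto simp: add.commute) (metis add.commute)+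
    ultimately show ?thesis using that \<open>sqrt_disc K \<noteq> 0\<close> by blast
  qed
qed

lemma sqrt_disc_nonzero: "sqrt_disc K \<noteq> 0"
  by (rule discriminant_basis)

lemma discriminant_nonzero: "discriminant K \<noteq> 0"
  using sqrt_disc_nonzero by (auto simp: sqrt_disc_def)

lemma cnj_sqrt_disc: "cnj (sqrt_disc K) = - sqrt_disc K"
  by (simp add: sqrt_disc_def)

lemma sqrt_disc_O: "sqrt_disc K \<in> \<O>"
proof -
  obtain u v where uv: "\<O> = int_span u v" "u * cnj v - v * cnj u = sqrt_disc K" by (rule discriminant_basis)
  have "u \<in> \<O>" "v \<in> \<O>"
    unfolding uv by (auto intro: int_spanI[of _ 1 _ 0] int_spanI[of _ 0 _ 1])
  then show ?thesis unfolding uv(2)[symmetric] by (intro O_closed)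
qed

text \<open>The trace of \<open>x * cnj y / sqrt_disc K\<close>, since conjugation negates the
  denominator. It takes the value 1 on the basis of \<open>discriminant_basis\<close>.\<close>

definition alt_form :: "complex \<Rightarrow> complex \<Rightarrow> complex" where
  "alt_form x y = (x * cnj y - y * cnj x) / sqrt_disc K"

lemma alt_form_Ints:
  assumes "x \<in> \<O>" "y \<in> \<O>"
  shows "alt_form x y \<in> \<int>"
proof -
  obtain u v where uv: "\<O> = int_span u v" "u * cnj v - v * cnj u = sqrt_disc K" by (rule discriminant_basis)
  obtain a b p q where "x = of_int a * u + of_int b * v" "y = of_int p * u + of_int q * v"
    using assms unfolding uv int_span_def by blast
  then have "x * cnj y - y * cnj x = of_int (a * q - b * p) * (u * cnj v - v * cnj u)"
    by (simp add: algebra_simps)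
  then show ?thesis unfolding alt_form_def uv(2) using sqrt_disc_nonzero by simp
qed

text \<open>Self-duality of \<open>\<O>\<close>: as the basis \<open>u\<close>, \<open>v\<close> has
  value 1, the coordinates of \<open>z\<close> are, up to sign, its values against \<open>v\<close>
  and \<open>u\<close>.\<close>

lemma O_if_alt_form_Ints:
  assumes "\<And>x. x \<in> \<O> \<Longrightarrow> alt_form z x \<in> \<int>"
  shows "z \<in> \<O>"
proof -
  obtain u v where uv: "\<O> = int_span u v" "u * cnj v - v * cnj u = sqrt_disc K" by (rule discriminant_basis)
  have "u \<in> \<O>" "v \<in> \<O>"
    unfolding uv by (auto intro: int_spanI[of _ 1 _ 0] int_spanI[of _ 0 _ 1])
  have *: "alt_form z x * sqrt_disc K = z * cnj x - x * cnj z" for x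
    unfolding alt_form_def using sqrt_disc_nonzero by simp
  have "(alt_form z v * u - alt_form z u * v) * sqrt_disc K
      = (alt_form z v * sqrt_disc K) * u - (alt_form z u * sqrt_disc K) * v"
    by (simp add: algebra_simps)
  also have "\<dots> = z * sqrt_disc K"
    unfolding * by (simp add: algebra_simps flip: uv(2))
  finally have "z * sqrt_disc K = (alt_form z v * u - alt_form z u * v) * sqrt_disc K" ..
  then have "z = alt_form z v * u - alt_form z u * v" using sqrt_disc_nonzero by simp
  also have "\<dots> \<in> \<O>"
    using assms \<open>u \<in> \<O>\<close> \<open>v \<in> \<O>\<close> by (intro O_diff O_mult O_Ints[of "alt_form _ _"])
  finally show ?thesis .
qed

end


section \<open>The ideal generated by a point and 1\<close>

lemma ideal_mult_mem: "i \<in> I \<Longrightarrow> j \<in> J \<Longrightarrow> i * j \<in> ideal_mult I J"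
  using ideal_prod.prod[of i I j J complex_field] by (simp add: ideal_mult_def complex_field_def)

lemma ideal_mult_add:
  "s \<in> ideal_mult I J \<Longrightarrow> t \<in> ideal_mult I J \<Longrightarrow> s + t \<in> ideal_mult I J"
  using ideal_prod.sum[of s complex_field I J t] by (simp add: ideal_mult_def complex_field_def)

lemma ideal_mult_subsetI:
  assumes "\<And>i j. i \<in> I \<Longrightarrow> j \<in> J \<Longrightarrow> i * j \<in> S"
    and "\<And>s t. s \<in> S \<Longrightarrow> t \<in> S \<Longrightarrow> s + t \<in> S"
  shows "ideal_mult I J \<subseteq> S"
proof
  fix x assume "x \<in> ideal_mult I J"
  then have "x \<in> ideal_prod complex_field I J" by (simp add: ideal_mult_def)
  then show "x \<in> S" by induction (use assms in \<open>simp_all add: complex_field_def\<close>)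
qed

lemma add_subgroup_scale:
  assumes "add_subgroup M"
  shows "add_subgroup (c *o M)"
  unfolding add_subgroup_def
proof (intro conjI ballI)
  show "0 \<in> c *o M" using set_times_intro2[OF add_subgroup_zero[OF assms], of c] by simp
  fix x y assume "x \<in> c *o M" "y \<in> c *o M"
  then obtain u v where "u \<in> M" "v \<in> M" "x - y = c * (u - v)"
    by (auto simp: elt_set_times_def right_diff_distrib)
  then show "x - y \<in> c *o M" using add_subgroup_diff[OF assms] by auto
qed

context imaginary_quadratic
begin

lemma ring_ring_of_integers: "ring (ring_of_integers K)"
proof -
  have "cring (ring_of_integers K)"
  proof (rule cringI)
    show "abelian_group (ring_of_integers K)"
    proof (rule abelian_groupI)
      fix x assume "x \<in> carrier (ring_of_integers K)"
      then show "\<exists>y\<in>carrier (ring_of_integers K). y \<oplus>\<^bsub>ring_of_integers K\<^esub> x = \<zero>\<^bsub>ring_of_integers K\<^esub>"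
        by (intro bexI[of _ "- x"]) (simp_all add: ring_of_integers_def complex_field_def O_closed)
    qed (simp_all add: ring_of_integers_def complex_field_def O_closed)
    show "comm_monoid (ring_of_integers K)"
      by (rule comm_monoidI) (simp_all add: ring_of_integers_def complex_field_def O_closed)
  qed (simp add: ring_of_integers_def complex_field_def distrib_right)
  then show ?thesis by (rule cring.axioms)
qed

lemma integral_idealI:
  assumes "add_subgroup M" "M \<subseteq> \<O>" "M \<noteq> {0}" "\<And>w s. w \<in> \<O> \<Longrightarrow> s \<in> M \<Longrightarrow> w * s \<in> M"
  shows "integral_ideal K M"
  unfolding integral_ideal_def
proof
  interpret R: ring "ring_of_integers K" by (rule ring_ring_of_integers)
  show "ideal M (ring_of_integers K)"
  proof (rule idealI)
    show "subgroup M (add_monoid (ring_of_integers K))"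
    proof (rule subgroup.intro)
      fix s assume s: "s \<in> M"
      have "\<ominus>\<^bsub>ring_of_integers K\<^esub> s = - s"
        by (rule R.minus_equality)
           (use s assms(2) O_minus in \<open>auto simp: ring_of_integers_def complex_field_def\<close>)
      then show "inv\<^bsub>add_monoid (ring_of_integers K)\<^esub> s \<in> M"
        using add_subgroup_minus[OF assms(1) s] by (simp add: a_inv_def)
    qed (use assms add_subgroup_zero[OF assms(1)] add_subgroup_add[OF assms(1)] in
        \<open>simp_all add: ring_of_integers_def complex_field_def\<close>)
    fix a w assume "a \<in> M" "w \<in> carrier (ring_of_integers K)"
    then have "w * a \<in> M" using assms(4) by (simp add: ring_of_integers_def complex_field_def)
    then show "w \<otimes>\<^bsub>ring_of_integers K\<^esub> a \<in> M" "a \<otimes>\<^bsub>ring_of_integers K\<^esub> w \<in> M"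
      by (simp_all add: ring_of_integers_def complex_field_def mult.commute)
  qed (rule ring_ring_of_integers)
qed fact

lemma integral_ideal_subset: "integral_ideal K I \<Longrightarrow> I \<subseteq> \<O>"
  using additive_subgroup.a_subset[OF ideal.axioms(1), of I "ring_of_integers K"]
  by (simp add: integral_ideal_def ring_of_integers_def)

lemma integral_ideal_imp_fractional:
  assumes "integral_ideal K I"
  shows "fractional_ideal K I"
  unfolding fractional_ideal_def using assms O_one by (intro bexI[of _ 1]) simp_all

lemma ideal_norm_integral:
  assumes "I \<subseteq> \<O>" "add_subgroup I"
  shows "ideal_norm K I = real (subgroup_index \<O> I)"
  using assms by (simp add: ideal_norm_def Int_absorb1 subgroup_index_self)

end

section \<open>The ideal generated by \<alpha> and 1, and its inverse\<close>

text \<open>The assumptions are what \<open>common_denominator\<close> gives for the trace and the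
  norm of \<alpha>. The polynomial with coefficients n, -t, m is primitive and has \<alpha> as a
  root; rational \<alpha> are included.\<close>

locale quadratic_point = imaginary_quadratic +
  fixes \<alpha> :: complex and n t m x y z :: int
  assumes \<alpha>: "\<alpha> \<in> K" and n_pos: "n > 0"
    and trace: "of_int n * (\<alpha> + cnj \<alpha>) = of_int t"
    and norm: "of_int n * (\<alpha> * cnj \<alpha>) = of_int m"
    and bezout: "x * n + y * t + z * m = 1"
    and denominator: "\<And>k. of_int k * (\<alpha> + cnj \<alpha>) \<in> \<int> \<and> of_int k * (\<alpha> * cnj \<alpha>) \<in> \<int> \<longleftrightarrow> n dvd k"
begin

abbreviation \<AA> :: "complex set" where "\<AA> \<equiv> ideal_gen2 K \<alpha> 1"

lemma n_nonzero: "(of_int n :: complex) \<noteq> 0"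
  using n_pos by simp

lemma n_norm_O: "of_int n * (\<alpha> * cnj \<alpha>) \<in> \<O>"
  unfolding norm by (rule O_of_int)

lemma n_\<alpha>_O: "of_int n * \<alpha> \<in> \<O>"
proof -
  have "of_int n * \<alpha> + cnj (of_int n * \<alpha>) = of_int n * (\<alpha> + cnj \<alpha>)"
    "(of_int n * \<alpha>) * cnj (of_int n * \<alpha>) = of_int n * (of_int n * (\<alpha> * cnj \<alpha>))"
    by (simp_all add: algebra_simps)
  then have "of_int n * \<alpha> + cnj (of_int n * \<alpha>) \<in> \<int>" "(of_int n * \<alpha>) * cnj (of_int n * \<alpha>) \<in> \<int>"
    unfolding trace norm by (metis Ints_of_int of_int_mult)+
  then show ?thesis unfolding integers_iff using \<alpha> K_mult K_Rats by simp
qed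

lemma n_cnj_\<alpha>_O: "of_int n * cnj \<alpha> \<in> \<O>"
  using O_cnj[OF n_\<alpha>_O] by simp

text \<open>Regrouping the Bezout relation as a combination of 1 and \<alpha> gives these
  coefficients. They lie in n times the conjugate of \<open>\<AA>\<close>, and they show that this
  is an inverse of \<open>\<AA>\<close>.\<close>

definition u0 :: complex where "u0 = of_int n * (of_int x + of_int y * cnj \<alpha>)"
definition u1 :: complex where "u1 = of_int n * (of_int y + of_int z * cnj \<alpha>)"

lemma unit_decomposition: "u0 + u1 * \<alpha> = 1"
proof -
  have "u0 + u1 * \<alpha> = of_int x * of_int n + of_int y * (of_int n * (\<alpha> + cnj \<alpha>))
      + of_int z * (of_int n * (\<alpha> * cnj \<alpha>))"
    by (simp add: u0_def u1_def algebra_simps)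
  also have "\<dots> = of_int (x * n + y * t + z * m)" unfolding trace norm by simp
  finally show ?thesis unfolding bezout by simp
qed

lemma u_eqs:
  "u0 = of_int x * of_int n + of_int y * (of_int n * cnj \<alpha>)"
  "u1 = of_int y * of_int n + of_int z * (of_int n * cnj \<alpha>)"
  by (simp_all add: u0_def u1_def algebra_simps)

lemma u_O: "u0 \<in> \<O>" "u1 \<in> \<O>" "u0 * \<alpha> \<in> \<O>" "u1 * \<alpha> \<in> \<O>"
proof -
  have "u0 * \<alpha> = of_int x * (of_int n * \<alpha>) + of_int y * (of_int n * (\<alpha> * cnj \<alpha>))"
    "u1 * \<alpha> = of_int y * (of_int n * \<alpha>) + of_int z * (of_int n * (\<alpha> * cnj \<alpha>))"
    by (simp_all add: u0_def u1_def algebra_simps)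
  then show "u0 * \<alpha> \<in> \<O>" "u1 * \<alpha> \<in> \<O>"
    using n_\<alpha>_O n_norm_O by (simp_all only: O_closed)
  show "u0 \<in> \<O>" "u1 \<in> \<O>" unfolding u_eqs using n_cnj_\<alpha>_O by (simp_all only: O_closed)
qed

lemma \<AA>_iff: "w \<in> \<AA> \<longleftrightarrow> (\<exists>p\<in>\<O>. \<exists>q\<in>\<O>. w = p + q * \<alpha>)"
  by (auto simp: ideal_gen2_def add.commute)

lemma \<AA>I: "p \<in> \<O> \<Longrightarrow> q \<in> \<O> \<Longrightarrow> p + q * \<alpha> \<in> \<AA>"
  unfolding \<AA>_iff by blast

lemma O_subset_\<AA>: "\<O> \<subseteq> \<AA>"
  using \<AA>I[OF _ O_zero] by auto

lemma add_subgroup_\<AA>: "add_subgroup \<AA>"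
  unfolding add_subgroup_def
proof (intro conjI ballI)
  show "0 \<in> \<AA>" using O_subset_\<AA> O_zero by auto
  fix v w assume "v \<in> \<AA>" "w \<in> \<AA>"
  then obtain p q p' q' where pq: "p \<in> \<O>" "q \<in> \<O>" "p' \<in> \<O>" "q' \<in> \<O>" "v = p + q * \<alpha>" "w = p' + q' * \<alpha>"
    unfolding \<AA>_iff by blast
  then have "v - w = (p - p') + (q - q') * \<alpha>" by (simp add: algebra_simps)
  also have "\<dots> \<in> \<AA>" using pq by (intro \<AA>I O_diff)
  finally show "v - w \<in> \<AA>" .
qed

lemma \<AA>_integral_multiples:
  assumes "w \<in> \<AA>"
  shows "of_int n * w \<in> \<O>" "of_int n * cnj \<alpha> * w \<in> \<O>" "u0 * w \<in> \<O>" "u1 * w \<in> \<O>"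
proof -
  obtain p q where pq: "p \<in> \<O>" "q \<in> \<O>" "w = p + q * \<alpha>"
    using assms unfolding \<AA>_iff by blast
  have "of_int n * w = of_int n * p + q * (of_int n * \<alpha>)"
    "of_int n * cnj \<alpha> * w = p * (of_int n * cnj \<alpha>) + q * (of_int n * (\<alpha> * cnj \<alpha>))"
    "u0 * w = u0 * p + u0 * \<alpha> * q" "u1 * w = u1 * p + u1 * \<alpha> * q"
    by (simp_all add: pq algebra_simps)
  then show "of_int n * w \<in> \<O>" "of_int n * cnj \<alpha> * w \<in> \<O>" "u0 * w \<in> \<O>" "u1 * w \<in> \<O>"
    using pq n_\<alpha>_O n_cnj_\<alpha>_O n_norm_O u_O by (simp_all only: O_closed)
qed

text \<open>Both sides are the inverse of \<open>\<AA>\<close>: the left one by definition, as 1 and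
  \<alpha> generate \<open>\<AA>\<close>, the right one by the Bezout relation.\<close>

lemma O_preimage: "{w \<in> \<O>. \<alpha> * w \<in> \<O>} = of_int n *o (cnj ` \<AA>)"
proof (intro equalityI subsetI)
  fix w assume "w \<in> of_int n *o (cnj ` \<AA>)"
  then obtain p q where pq: "p \<in> \<O>" "q \<in> \<O>" "w = of_int n * cnj (p + q * \<alpha>)"
    by (auto simp: elt_set_times_def \<AA>_iff)
  have "w = of_int n * cnj p + cnj q * (of_int n * cnj \<alpha>)"
    "\<alpha> * w = cnj p * (of_int n * \<alpha>) + cnj q * (of_int n * (\<alpha> * cnj \<alpha>))"
    by (simp_all add: pq algebra_simps)
  moreover have "of_int n * cnj p + cnj q * (of_int n * cnj \<alpha>) \<in> \<O>"
    "cnj p * (of_int n * \<alpha>) + cnj q * (of_int n * (\<alpha> * cnj \<alpha>)) \<in> \<O>"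
    using pq n_\<alpha>_O n_cnj_\<alpha>_O n_norm_O by (simp_all only: O_closed)
  ultimately show "w \<in> {w \<in> \<O>. \<alpha> * w \<in> \<O>}" by simp
next
  fix w assume w: "w \<in> {w \<in> \<O>. \<alpha> * w \<in> \<O>}"
  \<comment> \<open>Collecting \<open>w * (u0 + u1 * \<alpha>)\<close> by powers of
    \<open>cnj \<alpha>\<close> instead of \<alpha> gives n times
    \<open>?p + ?q * cnj \<alpha>\<close>.\<close>
  let ?p = "of_int x * w + of_int y * (\<alpha> * w)" and ?q = "of_int y * w + of_int z * (\<alpha> * w)"
  have "?p \<in> \<O>" "?q \<in> \<O>" using w by (simp_all only: O_closed mem_Collect_eq)
  then have "cnj ?p + cnj ?q * \<alpha> \<in> \<AA>" by (intro \<AA>I O_cnj)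
  then have "of_int n * cnj (cnj ?p + cnj ?q * \<alpha>) \<in> of_int n *o (cnj ` \<AA>)" by blast
  moreover have "of_int n * cnj (cnj ?p + cnj ?q * \<alpha>) = w * (u0 + u1 * \<alpha>)"
    by (simp add: u0_def u1_def algebra_simps)
  ultimately show "w \<in> of_int n *o (cnj ` \<AA>)" unfolding unit_decomposition by simp
qed

text \<open>Multiplying \<open>u0 + u1 * \<alpha> = 1\<close> by \<open>w\<close> leaves only
  products of \<open>u0\<close> or \<open>u1\<close> with elements of \<open>\<AA>\<close>, and
  these are integral.\<close>

lemma \<AA>_preimage: "{w \<in> \<AA>. \<alpha> * w \<in> \<AA>} = \<O>"
proof (intro equalityI subsetI)
  fix w assume w: "w \<in> {w \<in> \<AA>. \<alpha> * w \<in> \<AA>}"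
  have "w * (u0 + u1 * \<alpha>) = u0 * w + u1 * (\<alpha> * w)" by (simp add: algebra_simps)
  also have "\<dots> \<in> \<O>" using w \<AA>_integral_multiples by (intro O_add) auto
  finally show "w \<in> \<O>" unfolding unit_decomposition by simp
next
  fix w assume "w \<in> \<O>"
  then show "w \<in> {w \<in> \<AA>. \<alpha> * w \<in> \<AA>}"
    using O_subset_\<AA> \<AA>I[OF O_zero, of w] by (auto simp: mult.commute)
qed

section \<open>The square of the ideal\<close>

definition \<AA>\<AA> :: "complex set" where "\<AA>\<AA> = ideal_mult \<AA> \<AA>"

lemma \<AA>\<AA>_iff: "w \<in> \<AA>\<AA> \<longleftrightarrow> (\<exists>p\<in>\<O>. \<exists>q\<in>\<O>. \<exists>r\<in>\<O>. w = p + q * \<alpha> + r * (\<alpha> * \<alpha>))"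
proof
  let ?S = "{w. \<exists>p\<in>\<O>. \<exists>q\<in>\<O>. \<exists>r\<in>\<O>. w = p + q * \<alpha> + r * (\<alpha> * \<alpha>)}"
  have "\<AA>\<AA> \<subseteq> ?S"
    unfolding \<AA>\<AA>_def
  proof (rule ideal_mult_subsetI)
    fix v w assume "v \<in> \<AA>" "w \<in> \<AA>"
    then obtain p q p' q' where pq: "p \<in> \<O>" "q \<in> \<O>" "p' \<in> \<O>" "q' \<in> \<O>" "v = p + q * \<alpha>" "w = p' + q' * \<alpha>"
      unfolding \<AA>_iff by blast
    have "v * w = p * p' + (p * q' + q * p') * \<alpha> + (q * q') * (\<alpha> * \<alpha>)"
      by (simp add: pq algebra_simps)
    moreover have "p * p' \<in> \<O>" "p * q' + q * p' \<in> \<O>" "q * q' \<in> \<O>"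
      using pq by (simp_all only: O_closed)
    ultimately show "v * w \<in> ?S" by blast
  next
    fix v w assume "v \<in> ?S" "w \<in> ?S"
    then obtain p q r p' q' r' where pq: "p \<in> \<O>" "q \<in> \<O>" "r \<in> \<O>" "p' \<in> \<O>" "q' \<in> \<O>" "r' \<in> \<O>"
      "v = p + q * \<alpha> + r * (\<alpha> * \<alpha>)" "w = p' + q' * \<alpha> + r' * (\<alpha> * \<alpha>)" by blast
    have "v + w = (p + p') + (q + q') * \<alpha> + (r + r') * (\<alpha> * \<alpha>)"
      by (simp add: pq algebra_simps)
    moreover have "p + p' \<in> \<O>" "q + q' \<in> \<O>" "r + r' \<in> \<O>"
      using pq by (simp_all only: O_closed)
    ultimately show "v + w \<in> ?S" by blast
  qed
  then show "w \<in> \<AA>\<AA> \<Longrightarrow> \<exists>p\<in>\<O>. \<exists>q\<in>\<O>. \<exists>r\<in>\<O>. w = p + q * \<alpha> + r * (\<alpha> * \<alpha>)" by blast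
next
  assume "\<exists>p\<in>\<O>. \<exists>q\<in>\<O>. \<exists>r\<in>\<O>. w = p + q * \<alpha> + r * (\<alpha> * \<alpha>)"
  then obtain p q r where pq: "p \<in> \<O>" "q \<in> \<O>" "r \<in> \<O>" "w = p + q * \<alpha> + r * (\<alpha> * \<alpha>)" by blast
  have "p + q * \<alpha> \<in> \<AA>" "1 \<in> \<AA>" "r * \<alpha> \<in> \<AA>" "\<alpha> \<in> \<AA>"
    using \<AA>I[OF pq(1,2)] O_subset_\<AA> O_one \<AA>I[OF O_zero pq(3)] \<AA>I[OF O_zero O_one] by auto
  then have "(p + q * \<alpha>) * 1 + (r * \<alpha>) * \<alpha> \<in> ideal_mult \<AA> \<AA>"
    by (intro ideal_mult_add ideal_mult_mem)
  then show "w \<in> \<AA>\<AA>" by (simp add: pq \<AA>\<AA>_def algebra_simps)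
qed

lemma \<AA>\<AA>I: "p \<in> \<O> \<Longrightarrow> q \<in> \<O> \<Longrightarrow> r \<in> \<O> \<Longrightarrow> p + q * \<alpha> + r * (\<alpha> * \<alpha>) \<in> \<AA>\<AA>"
  unfolding \<AA>\<AA>_iff by blast

lemma \<AA>\<AA>_basis: "1 \<in> \<AA>\<AA>" "\<alpha> \<in> \<AA>\<AA>" "\<alpha> * \<alpha> \<in> \<AA>\<AA>"
  using \<AA>\<AA>I[OF O_one O_zero O_zero] \<AA>\<AA>I[OF O_zero O_one O_zero] \<AA>\<AA>I[OF O_zero O_zero O_one] by simp_all

lemma \<AA>_subset_\<AA>\<AA>: "\<AA> \<subseteq> \<AA>\<AA>"
  using \<AA>\<AA>I[OF _ _ O_zero] by (auto simp: \<AA>_iff)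

lemma add_subgroup_\<AA>\<AA>: "add_subgroup \<AA>\<AA>"
  unfolding add_subgroup_def
proof (intro conjI ballI)
  show "0 \<in> \<AA>\<AA>" using \<AA>\<AA>I[OF O_zero O_zero O_zero] by simp
  fix v w assume "v \<in> \<AA>\<AA>" "w \<in> \<AA>\<AA>"
  then obtain p q r p' q' r' where pq: "p \<in> \<O>" "q \<in> \<O>" "r \<in> \<O>" "p' \<in> \<O>" "q' \<in> \<O>" "r' \<in> \<O>"
    "v = p + q * \<alpha> + r * (\<alpha> * \<alpha>)" "w = p' + q' * \<alpha> + r' * (\<alpha> * \<alpha>)" unfolding \<AA>\<AA>_iff by blast
  have "v - w = (p - p') + (q - q') * \<alpha> + (r - r') * (\<alpha> * \<alpha>)"
    by (simp add: pq algebra_simps)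
  then show "v - w \<in> \<AA>\<AA>" using pq by (simp only:) (intro \<AA>\<AA>I O_diff)
qed

lemma \<AA>\<AA>_O_mult: "w \<in> \<O> \<Longrightarrow> s \<in> \<AA>\<AA> \<Longrightarrow> w * s \<in> \<AA>\<AA>"
proof -
  assume w: "w \<in> \<O>" "s \<in> \<AA>\<AA>"
  then obtain p q r where pq: "p \<in> \<O>" "q \<in> \<O>" "r \<in> \<O>" "s = p + q * \<alpha> + r * (\<alpha> * \<alpha>)"
    unfolding \<AA>\<AA>_iff by blast
  have "w * s = w * p + (w * q) * \<alpha> + (w * r) * (\<alpha> * \<alpha>)" by (simp add: pq algebra_simps)
  then show ?thesis using pq w by (simp only:) (intro \<AA>\<AA>I O_mult)
qed

text \<open>A multiplier that carries \<open>\<AA>\<close> into \<open>\<O>\<close> carries the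
  square of \<open>\<AA>\<close> into \<open>\<AA>\<close>.\<close>

lemma \<AA>\<AA>_multiples:
  assumes "s \<in> \<AA>\<AA>"
  shows "of_int n * s \<in> \<AA>" "u0 * s \<in> \<AA>" "u1 * s \<in> \<AA>"
proof -
  obtain p q r where pq: "p \<in> \<O>" "q \<in> \<O>" "r \<in> \<O>" "s = p + q * \<alpha> + r * (\<alpha> * \<alpha>)"
    using assms unfolding \<AA>\<AA>_iff by blast
  have *: "w * s \<in> \<AA>" if "w \<in> \<O>" "w * \<alpha> \<in> \<O>" for w
  proof -
    have "w * s = (w * p + (w * \<alpha>) * q) + ((w * \<alpha>) * r) * \<alpha>" by (simp add: pq algebra_simps)
    also have "\<dots> \<in> \<AA>"
      by (rule \<AA>I[OF O_add[OF O_mult[OF that(1) pq(1)] O_mult[OF that(2) pq(2)]] O_mult[OF that(2) pq(3)]])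
    finally show ?thesis .
  qed
  show "of_int n * s \<in> \<AA>" "u0 * s \<in> \<AA>" "u1 * s \<in> \<AA>"
    using n_\<alpha>_O u_O O_of_int by (intro *; simp)+
qed

text \<open>The squared decomposition witnesses that the square of \<open>\<AA>\<close> is
  invertible: its three coefficients carry that square into \<open>\<O>\<close>.\<close>

lemma unit_decomposition_square: "u0 * u0 + (2 * u0 * u1) * \<alpha> + (u1 * u1) * (\<alpha> * \<alpha>) = 1"
proof -
  have "u0 * u0 + (2 * u0 * u1) * \<alpha> + (u1 * u1) * (\<alpha> * \<alpha>) = (u0 + u1 * \<alpha>) * (u0 + u1 * \<alpha>)"
    by (simp add: algebra_simps)
  then show ?thesis unfolding unit_decomposition by simp
qed

lemma \<AA>\<AA>_integral_multiples:
  assumes "s \<in> \<AA>\<AA>"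
  shows "u0 * u0 * s \<in> \<O>" "2 * u0 * u1 * s \<in> \<O>" "u1 * u1 * s \<in> \<O>"
proof -
  have "u0 * (u0 * s) \<in> \<O>" "u0 * (u1 * s) \<in> \<O>" "u1 * (u1 * s) \<in> \<O>"
    using \<AA>_integral_multiples \<AA>\<AA>_multiples[OF assms] by auto
  moreover from this(2) have "of_int 2 * (u0 * (u1 * s)) \<in> \<O>" by (rule O_mult[OF O_of_int])
  ultimately show "u0 * u0 * s \<in> \<O>" "2 * u0 * u1 * s \<in> \<O>" "u1 * u1 * s \<in> \<O>" by (simp_all add: mult.assoc)
qed

lemma O_if_\<AA>\<AA>_stable:
  assumes "\<And>s. s \<in> \<AA>\<AA> \<Longrightarrow> w * s \<in> \<AA>\<AA>"
  shows "w \<in> \<O>"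
proof -
  have "w = w * (u0 * u0 + (2 * u0 * u1) * \<alpha> + (u1 * u1) * (\<alpha> * \<alpha>))"
    unfolding unit_decomposition_square by simp
  also have "\<dots> = u0 * u0 * (w * 1) + 2 * u0 * u1 * (w * \<alpha>) + u1 * u1 * (w * (\<alpha> * \<alpha>))"
    by (simp add: algebra_simps)
  also have "\<dots> \<in> \<O>"
    using assms \<AA>\<AA>_basis by (intro O_add \<AA>\<AA>_integral_multiples)
  finally show ?thesis .
qed

section \<open>Indices and norms from covolumes\<close>

lemma \<AA>_covolume: "\<exists>c. has_covolume \<AA> c"
proof -
  obtain c0 where c0: "has_covolume \<O> c0" using O_covolume by blast
  let ?H = "of_int n *o \<AA>"
  have "has_covolume ?H (real (subgroup_index \<O> ?H) * c0)"
  proof (rule has_covolume_subgroup[OF c0, where k = n])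
    show "add_subgroup ?H" by (rule add_subgroup_scale[OF add_subgroup_\<AA>])
    show "?H \<subseteq> \<O>" using \<AA>_integral_multiples(1) by (auto simp: elt_set_times_def)
    show "of_int n * w \<in> ?H" if "w \<in> \<O>" for w using that O_subset_\<AA> by auto
  qed (rule n_pos)
  from has_covolume_scale[OF this, of "inverse (of_int n)"] show ?thesis
    using n_nonzero by (auto simp: set_times_rearrange2)
qed

text \<open>The inverse of \<open>\<AA>\<close> is \<open>n\<close> times its conjugate, and multiplication by \<open>\<alpha>\<close> identifies
  \<open>\<O>\<close> modulo the inverse with \<open>\<AA>\<close> modulo \<open>\<O>\<close>; comparing covolumes, the square of the
  common index is \<open>n\<^sup>2\<close>.\<close>

lemma index_\<AA>_O: "subgroup_index \<AA> \<O> = nat n"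
proof -
  obtain c0 where c0: "has_covolume \<O> c0" using O_covolume by blast
  obtain c where c: "has_covolume \<AA> c" using \<AA>_covolume by blast
  let ?i = "subgroup_index \<AA> \<O>"
  have "has_covolume \<O> (real ?i * c)"
    by (rule has_covolume_subgroup[OF c add_subgroup_O O_subset_\<AA> n_pos])
       (rule \<AA>_integral_multiples)
  then have 1: "c0 = real ?i * c" using has_covolume_unique c0 by blast
  have "?i = subgroup_index \<O> {w \<in> \<O>. \<alpha> * w \<in> \<O>}"
  proof (rule subgroup_index_preimage[OF add_subgroup_O add_subgroup_O])
    show "(*) \<alpha> ` \<O> \<subseteq> \<AA>" using \<AA>I[OF O_zero] by (auto simp: mult.commute)
    show "\<exists>v\<in>\<O>. w - \<alpha> * v \<in> \<O>" if "w \<in> \<AA>" for w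
      using that by (force simp: \<AA>_iff mult.commute)
  qed (simp add: right_diff_distrib)
  then have i: "?i = subgroup_index \<O> (of_int n *o (cnj ` \<AA>))" unfolding O_preimage .
  have sub: "has_covolume (of_int n *o (cnj ` \<AA>)) ((cmod (of_int n))\<^sup>2 * c)"
    by (rule has_covolume_scale[OF has_covolume_cnj[OF c] n_nonzero])
  have "has_covolume (of_int n *o (cnj ` \<AA>)) (real (subgroup_index \<O> (of_int n *o (cnj ` \<AA>))) * c0)"
  proof (rule has_covolume_subgroup[OF c0 _ _ n_pos])
    show "add_subgroup (of_int n *o (cnj ` \<AA>))" using sub by (rule has_covolume_add_subgroup)
    show "of_int n *o (cnj ` \<AA>) \<subseteq> \<O>" using O_preimage by blast
    show "of_int n * w \<in> of_int n *o (cnj ` \<AA>)" if "w \<in> \<O>" for w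
    proof -
      have "cnj w \<in> \<AA>" using that O_cnj O_subset_\<AA> by blast
      then have "cnj (cnj w) \<in> cnj ` \<AA>" by (rule imageI)
      then show ?thesis by auto
    qed
  qed
  then have "(cmod (of_int n))\<^sup>2 * c = real ?i * c0"
    unfolding i using has_covolume_unique sub by blast
  then have "(of_int n)\<^sup>2 = (real ?i)\<^sup>2"
    unfolding 1 using has_covolume_pos[OF c] by (simp add: power2_eq_square)
  then have "of_int n = real ?i" using n_pos by (simp add: power2_eq_iff_nonneg)
  then show ?thesis using n_pos by linarith
qed

lemma ideal_norm_\<AA>: "ideal_norm K \<AA> = 1 / of_int n"
  using O_subset_\<AA> n_pos
  by (simp add: ideal_norm_def Int_absorb2 subgroup_index_self[OF add_subgroup_O] index_\<AA>_O)

text \<open>Multiplication by \<alpha> identifies \<open>\<AA>\<close> modulo \<open>\<O>\<close>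
  with \<open>\<AA>\<AA>\<close> modulo \<open>\<AA>\<close>, by \<open>\<AA>_preimage\<close>. So
  each of the two steps from \<open>\<O>\<close> up to \<open>\<AA>\<AA>\<close> has index
  n.\<close>

lemma \<AA>\<AA>_covolume:
  assumes "has_covolume \<O> c0"
  shows "has_covolume \<AA>\<AA> (c0 / (of_int n)\<^sup>2)"
proof -
  obtain c where c: "has_covolume \<AA> c" using \<AA>_covolume by blast
  let ?H = "of_int n *o \<AA>\<AA>"
  have "has_covolume ?H (real (subgroup_index \<AA> ?H) * c)"
  proof (rule has_covolume_subgroup[OF c, where k = n])
    show "add_subgroup ?H" by (rule add_subgroup_scale[OF add_subgroup_\<AA>\<AA>])
    show "?H \<subseteq> \<AA>" using \<AA>\<AA>_multiples(1) by (auto simp: elt_set_times_def)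
    show "of_int n * w \<in> ?H" if "w \<in> \<AA>" for w using that \<AA>_subset_\<AA>\<AA> by auto
  qed (rule n_pos)
  from has_covolume_scale[OF this, of "inverse (of_int n)"]
  obtain c2 where c2: "has_covolume \<AA>\<AA> c2"
    using n_nonzero by (auto simp: set_times_rearrange2)
  have "has_covolume \<O> (real (subgroup_index \<AA> \<O>) * c)"
    by (rule has_covolume_subgroup[OF c add_subgroup_O O_subset_\<AA> n_pos])
       (rule \<AA>_integral_multiples)
  then have 1: "c0 = of_int n * c"
    using has_covolume_unique[OF assms] n_pos by (simp add: index_\<AA>_O)
  have "has_covolume \<AA> (real (subgroup_index \<AA>\<AA> \<AA>) * c2)"
    by (rule has_covolume_subgroup[OF c2 add_subgroup_\<AA> \<AA>_subset_\<AA>\<AA> n_pos])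
       (rule \<AA>\<AA>_multiples)
  moreover have "subgroup_index \<AA>\<AA> \<AA> = subgroup_index \<AA> {w \<in> \<AA>. \<alpha> * w \<in> \<AA>}"
  proof (rule subgroup_index_preimage[OF add_subgroup_\<AA> add_subgroup_\<AA>])
    show "(*) \<alpha> ` \<AA> \<subseteq> \<AA>\<AA>"
    proof
      fix w assume "w \<in> (*) \<alpha> ` \<AA>"
      then obtain p q where "p \<in> \<O>" "q \<in> \<O>" "w = \<alpha> * (p + q * \<alpha>)" by (auto simp: \<AA>_iff)
      then show "w \<in> \<AA>\<AA>" using \<AA>\<AA>I[OF O_zero, of p q] by (simp add: algebra_simps)
    qed
    show "\<exists>v\<in>\<AA>. w - \<alpha> * v \<in> \<AA>" if w: "w \<in> \<AA>\<AA>" for w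
    proof -
      obtain p q r where pq: "p \<in> \<O>" "q \<in> \<O>" "r \<in> \<O>" "w = p + q * \<alpha> + r * (\<alpha> * \<alpha>)"
        using w unfolding \<AA>\<AA>_iff by blast
      have "w - \<alpha> * (0 + r * \<alpha>) = p + q * \<alpha>" by (simp add: pq)
      then show ?thesis using \<AA>I[OF O_zero pq(3)] \<AA>I[OF pq(1,2)] by metis
    qed
  qed (simp add: right_diff_distrib)
  ultimately have "c = of_int n * c2"
    unfolding \<AA>_preimage using has_covolume_unique[OF c] n_pos by (simp add: index_\<AA>_O)
  then have "c2 = c0 / (of_int n)\<^sup>2" using 1 n_pos by (simp add: power2_eq_square)
  then show ?thesis using c2 by simp
qed

lemma scaled_\<AA>\<AA>_integral_ideal:
  assumes "c \<noteq> 0" "c *o \<AA>\<AA> \<subseteq> \<O>"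
  shows "integral_ideal K (c *o \<AA>\<AA>)"
proof (rule integral_idealI[OF add_subgroup_scale[OF add_subgroup_\<AA>\<AA>] assms(2)])
  have "c * 1 \<in> c *o \<AA>\<AA>" using \<AA>\<AA>_basis by blast
  then show "c *o \<AA>\<AA> \<noteq> {0}" using assms(1) by auto
  fix w s assume "w \<in> \<O>" "s \<in> c *o \<AA>\<AA>"
  then obtain v where "v \<in> \<AA>\<AA>" "w * s = c * (w * v)" by (auto simp: elt_set_times_def)
  then show "w * s \<in> c *o \<AA>\<AA>"
    using set_times_intro2[OF \<AA>\<AA>_O_mult[OF \<open>w \<in> \<O>\<close>]] by metis
qed

lemma ideal_norm_scaled_\<AA>\<AA>:
  assumes c: "c \<in> K" "c \<noteq> 0" "c *o \<AA>\<AA> \<subseteq> \<O>"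
  shows "ideal_norm K (c *o \<AA>\<AA>) = (cmod c)\<^sup>2 / (of_int n)\<^sup>2"
proof -
  obtain c0 where c0: "has_covolume \<O> c0" using O_covolume by blast
  have sub: "add_subgroup (c *o \<AA>\<AA>)" by (rule add_subgroup_scale[OF add_subgroup_\<AA>\<AA>])
  \<comment> \<open>A denominator of \<open>1 / c\<close> puts \<open>k\<close> times
    \<open>\<O>\<close> inside the ideal, as the sublattice lemma requires.\<close>
  obtain k where k: "k > 0" "of_int k * inverse c \<in> \<O>"
    using integral_multiple[OF K_inverse[OF c(1)]] by blast
  have "has_covolume (c *o \<AA>\<AA>) (real (subgroup_index \<O> (c *o \<AA>\<AA>)) * c0)"
  proof (rule has_covolume_subgroup[OF c0 sub c(3) k(1)])
    fix w assume "w \<in> \<O>"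
    then have "(of_int k * inverse c) * w \<in> \<AA>\<AA>"
      using k(2) O_mult O_subset_\<AA> \<AA>_subset_\<AA>\<AA> by blast
    then have "c * ((of_int k * inverse c) * w) \<in> c *o \<AA>\<AA>" by blast
    then show "of_int k * w \<in> c *o \<AA>\<AA>" using c(2) by (simp add: field_simps)
  qed
  then have "real (subgroup_index \<O> (c *o \<AA>\<AA>)) * c0 = (cmod c)\<^sup>2 * (c0 / (of_int n)\<^sup>2)"
    using has_covolume_unique has_covolume_scale[OF \<AA>\<AA>_covolume[OF c0] c(2)] by blast
  then have "real (subgroup_index \<O> (c *o \<AA>\<AA>)) * c0 = (cmod c)\<^sup>2 / (of_int n)\<^sup>2 * c0"
    by simp
  then have "real (subgroup_index \<O> (c *o \<AA>\<AA>)) = (cmod c)\<^sup>2 / (of_int n)\<^sup>2"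
    using has_covolume_pos[OF c0] by (simp only: mult_cancel_right) simp
  then show ?thesis using ideal_norm_integral[OF c(3) sub] by simp
qed

text \<open>Invertibility of the square of \<open>\<AA>\<close> cancels it from the quotient. The
  inclusion from right to left needs the explicit coefficients of
  \<open>unit_decomposition_square\<close>, multiplied by the given element.\<close>

lemma ideal_quotient_scaled_\<AA>\<AA>:
  assumes c: "c \<in> K" "c' \<in> K" "c' \<noteq> 0"
  shows "ideal_quotient K (c *o \<AA>\<AA>) (c' *o \<AA>\<AA>) = (c / c') *o \<O>"
  unfolding ideal_quotient_def
proof (intro equalityI)
  show "ideal_mult (c *o \<AA>\<AA>) (ideal_inverse K (c' *o \<AA>\<AA>)) \<subseteq> (c / c') *o \<O>"
  proof (rule ideal_mult_subsetI)
    fix i j assume "i \<in> c *o \<AA>\<AA>" "j \<in> ideal_inverse K (c' *o \<AA>\<AA>)"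
    then obtain s where s: "s \<in> \<AA>\<AA>" "i = c * s" "j * (c' * s) \<in> \<O>"
      by (auto simp: elt_set_times_def ideal_inverse_def)
    have "i * j = (c / c') * (j * (c' * s))" using c(3) by (simp add: s)
    then show "i * j \<in> (c / c') *o \<O>" using set_times_intro2[OF s(3)] by metis
  next
    fix s t assume "s \<in> (c / c') *o \<O>" "t \<in> (c / c') *o \<O>"
    then show "s + t \<in> (c / c') *o \<O>"
      using add_subgroup_add[OF add_subgroup_scale[OF add_subgroup_O]] by blast
  qed
  show "(c / c') *o \<O> \<subseteq> ideal_mult (c *o \<AA>\<AA>) (ideal_inverse K (c' *o \<AA>\<AA>))"
  proof
    fix w assume "w \<in> (c / c') *o \<O>"
    then obtain o' where o': "o' \<in> \<O>" "w = (c / c') * o'" by (auto simp: elt_set_times_def)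
    have inv: "v * o' / c' \<in> ideal_inverse K (c' *o \<AA>\<AA>)"
      if "v \<in> \<O>" "\<And>s. s \<in> \<AA>\<AA> \<Longrightarrow> v * s \<in> \<O>" for v
      unfolding ideal_inverse_def
    proof (safe)
      show "v * o' / c' \<in> K" using that(1) o' c O_subset_K by (intro K_divide K_mult) auto
      fix r assume "r \<in> c' *o \<AA>\<AA>"
      then obtain s where s: "s \<in> \<AA>\<AA>" "r = c' * s" by (auto simp: elt_set_times_def)
      have "v * o' / c' * r = o' * (v * s)" using c(3) by (simp add: s mult_ac)
      then show "v * o' / c' * r \<in> \<O>" using O_mult[OF o'(1) that(2)[OF s(1)]] by simp
    qed
    have "(c * 1) * (u0 * u0 * o' / c') + (c * \<alpha>) * (2 * u0 * u1 * o' / c')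
        + (c * (\<alpha> * \<alpha>)) * (u1 * u1 * o' / c') \<in> ideal_mult (c *o \<AA>\<AA>) (ideal_inverse K (c' *o \<AA>\<AA>))"
      using \<AA>\<AA>_basis \<AA>\<AA>_integral_multiples \<AA>\<AA>_integral_multiples[OF \<AA>\<AA>_basis(1)]
      by (intro ideal_mult_add ideal_mult_mem inv set_times_intro2) simp_all
    also have "(c * 1) * (u0 * u0 * o' / c') + (c * \<alpha>) * (2 * u0 * u1 * o' / c')
        + (c * (\<alpha> * \<alpha>)) * (u1 * u1 * o' / c')
        = (c / c') * o' * (u0 * u0 + (2 * u0 * u1) * \<alpha> + (u1 * u1) * (\<alpha> * \<alpha>))"
      by (simp add: algebra_simps add_divide_distrib)
    finally show "w \<in> ideal_mult (c *o \<AA>\<AA>) (ideal_inverse K (c' *o \<AA>\<AA>))"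
      unfolding unit_decomposition_square o'(2) by simp
  qed
qed

end


section \<open>Oriented circles through a point\<close>

lemma vector_4:
  "(vector [a, b, c, d] :: 'a::zero ^ 4) $ 1 = a" "(vector [a, b, c, d] :: 'a ^ 4) $ 2 = b"
  "(vector [a, b, c, d] :: 'a ^ 4) $ 3 = c" "(vector [a, b, c, d] :: 'a ^ 4) $ 4 = d"
  unfolding vector_def by simp_all

lemma Some_in_circle_points_iff:
  "Some w \<in> circle_points C \<longleftrightarrow>
     curvature C * (cmod w)\<^sup>2 - 2 * Re (cnj w * center C) + cocurvature C = 0"
proof
  assume "Some w \<in> circle_points C"
  then obtain a b where "Some w = proj_point a b"
    and eq: "curvature C * (cmod a)\<^sup>2 - 2 * Re (cnj a * b * center C) + cocurvature C * (cmod b)\<^sup>2 = 0"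
    unfolding circle_points_def by blast
  then have ab: "b \<noteq> 0" "a = w * b" by (auto simp: proj_point_def split: if_splits)
  have "cnj a * b * center C = of_real ((cmod b)\<^sup>2) * (cnj w * center C)"
    unfolding ab complex_norm_square by simp
  moreover have "Re (of_real r * v) = r * Re v" for r v by simp
  ultimately have "Re (cnj a * b * center C) = (cmod b)\<^sup>2 * Re (cnj w * center C)"
    by (simp only:)
  then have "(cmod b)\<^sup>2 * (curvature C * (cmod w)\<^sup>2 - 2 * Re (cnj w * center C) + cocurvature C) = 0"
    using eq unfolding ab(2) norm_mult power_mult_distrib by (simp only: algebra_simps)
  then show "curvature C * (cmod w)\<^sup>2 - 2 * Re (cnj w * center C) + cocurvature C = 0"
    using ab(1) by simp
next
  assume *: "curvature C * (cmod w)\<^sup>2 - 2 * Re (cnj w * center C) + cocurvature C = 0"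
  show "Some w \<in> circle_points C"
    unfolding circle_points_def
    by (rule CollectI, rule exI[of _ w], rule exI[of _ 1]) (use * in \<open>simp add: proj_point_def\<close>)
qed

lemma None_in_circle_points_iff: "None \<in> circle_points C \<longleftrightarrow> curvature C = 0"
proof
  assume "None \<in> circle_points C"
  then show "curvature C = 0"
    by (auto simp: circle_points_def proj_point_def split: if_splits)
next
  assume *: "curvature C = 0"
  show "None \<in> circle_points C"
    unfolding circle_points_def
    by (rule CollectI, rule exI[of _ 1], rule exI[of _ 0]) (use * in \<open>simp add: proj_point_def\<close>)
qed

text \<open>Translating \<open>w\<close> to the origin turns the curvature-center into this vector, which for an oriented
  circle through \<open>w\<close> is a unit normal vector there.\<close>

definition normal_at :: "circle \<Rightarrow> complex \<Rightarrow> complex" where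
  "normal_at C w = center C - of_real (curvature C) * w"

lemma cmod_square: "(cmod z)\<^sup>2 = (Re z)\<^sup>2 + (Im z)\<^sup>2"
  by (simp add: cmod_power2)

lemma cmod_normal_at:
  assumes "Some w \<in> circle_points C"
  shows "oriented_circle C \<longleftrightarrow> cmod (normal_at C w) = 1"
proof -
  have coc: "cocurvature C = 2 * Re (cnj w * center C) - curvature C * (cmod w)\<^sup>2"
    using assms unfolding Some_in_circle_points_iff by simp
  have "(cmod (normal_at C w))\<^sup>2 = (cmod (center C))\<^sup>2 - curvature C * cocurvature C"
    unfolding coc normal_at_def cmod_square by (simp add: power2_eq_square algebra_simps)
  then show ?thesis
    unfolding oriented_circle_def by (metis norm_ge_zero one_power2 power2_eq_iff_nonneg zero_le_one)
qed

text \<open>The form is invariant under translation. With \<open>w\<close> moved to the origin both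
  cocurvatures vanish, and only the Euclidean product of the normal vectors remains.\<close>

lemma inner_Q_through_point:
  assumes "Some w \<in> circle_points C" "Some w \<in> circle_points C'"
  shows "inner_Q (circle_vec C) (circle_vec C') = of_real (Re (normal_at C w * cnj (normal_at C' w)))"
proof -
  have coc: "cocurvature C = 2 * Re (cnj w * center C) - curvature C * (cmod w)\<^sup>2"
    "cocurvature C' = 2 * Re (cnj w * center C') - curvature C' * (cmod w)\<^sup>2"
    using assms unfolding Some_in_circle_points_iff by simp_all
  show ?thesis
    unfolding inner_Q_def circle_vec_def vector_4 coc normal_at_def cmod_square
    by (simp add: complex_eq_iff power2_eq_square field_simps)
qed

lemma arccos_Re_unit:
  assumes "cmod g = 1"
  shows "arccos (Re g) = \<bar>Arg g\<bar>"
proof -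
  have "g \<noteq> 0" using assms by auto
  have "g = cis (Arg g)" using assms cis_Arg[OF \<open>g \<noteq> 0\<close>] by (simp add: sgn_div_norm)
  then have "Re g = cos (Arg g)" by (metis cis.simps(1))
  moreover have "\<bar>Arg g\<bar> \<le> pi" using Arg_bounded[of g] by auto
  ultimately show ?thesis by (simp add: arccos_cos_eq_abs)
qed

lemma cis_abs_Arg_unit:
  assumes "cmod g = 1"
  shows "cis \<bar>Arg g\<bar> = g \<or> cis \<bar>Arg g\<bar> = cnj g"
proof -
  have "g \<noteq> 0" using assms by auto
  have "g = cis (Arg g)" using assms cis_Arg[OF \<open>g \<noteq> 0\<close>] by (simp add: sgn_div_norm)
  then show ?thesis by (metis abs_if cis_cnj)
qed

text \<open>The first form serves the comparison of scaled normals, the second the generators of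
  ideals, which involve the conjugates.\<close>

lemma circle_angle_through_point:
  assumes "oriented_circle C" "oriented_circle C'"
    and "Some w \<in> circle_points C" "Some w \<in> circle_points C'"
  shows "circle_angle C C' = \<bar>Arg (normal_at C w / normal_at C' w)\<bar>"
    "circle_angle C C' = \<bar>Arg (cnj (normal_at C w) / cnj (normal_at C' w))\<bar>"
proof -
  let ?u = "normal_at C w" let ?u' = "normal_at C' w"
  have unit: "cmod ?u = 1" "cmod ?u' = 1" using assms cmod_normal_at by auto
  have "?u' * cnj ?u' = 1" using unit complex_norm_square[of ?u'] by simp
  then have "inverse ?u' = cnj ?u'" by (rule inverse_unique)
  then have *: "?u / ?u' = ?u * cnj ?u'" "cnj ?u / cnj ?u' = cnj (?u * cnj ?u')"
    by (metis divide_inverse complex_cnj_divide)+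
  have "circle_angle C C' = arccos (Re (?u * cnj ?u'))"
    unfolding circle_angle_def inner_Q_through_point[OF assms(3,4)] by simp
  then show "circle_angle C C' = \<bar>Arg (?u / ?u')\<bar>" "circle_angle C C' = \<bar>Arg (cnj ?u / cnj ?u')\<bar>"
    using arccos_Re_unit[of "?u / ?u'"] arccos_Re_unit[of "cnj ?u / cnj ?u'"] unit
    unfolding * by (simp_all add: norm_mult)
qed

text \<open>The squared distance of two unit vectors is 2 minus twice their inner product.\<close>

lemma inner_Q_eq_1_iff:
  assumes "oriented_circle C" "oriented_circle C'"
    and "Some w \<in> circle_points C" "Some w \<in> circle_points C'"
  shows "inner_Q (circle_vec C) (circle_vec C') = 1 \<longleftrightarrow> normal_at C w = normal_at C' w"
proof -
  let ?u = "normal_at C w" let ?u' = "normal_at C' w"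
  have "(cmod ?u)\<^sup>2 = 1" "(cmod ?u')\<^sup>2 = 1" using assms cmod_normal_at by auto
  then have "(cmod (?u - ?u'))\<^sup>2 = 2 - 2 * Re (?u * cnj ?u')"
    unfolding cmod_square by (simp add: power2_eq_square algebra_simps)
  moreover have "inner_Q (circle_vec C) (circle_vec C') = 1 \<longleftrightarrow> Re (?u * cnj ?u') = 1"
    unfolding inner_Q_through_point[OF assms(3,4)] by (metis of_real_1 of_real_eq_iff)
  moreover have "?u = ?u' \<longleftrightarrow> (cmod (?u - ?u'))\<^sup>2 = 0" by simp
  ultimately show ?thesis by linarith
qed

text \<open>With \<open>d = v - w\<close> a circle has the equation: curvature times the square of
  |d| equals \<open>2 * Re (cnj d * normal)\<close>. Equal normals and different curvatures leave
  only \<open>d = 0\<close>; at infinity both curvatures would be 0.\<close>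

lemma tangent_circles_meet_once:
  assumes "Some w \<in> circle_points C" "Some w \<in> circle_points C'"
    and "normal_at C w = normal_at C' w" "curvature C \<noteq> curvature C'"
    and "p \<in> circle_points C" "p \<in> circle_points C'"
  shows "p = Some w"
proof (cases p)
  case None
  then show ?thesis using assms by (simp add: None_in_circle_points_iff)
next
  case (Some v)
  have eq: "curvature C * (cmod (v - w))\<^sup>2 = 2 * Re (cnj (v - w) * normal_at C w)"
    if "Some w \<in> circle_points C" "Some v \<in> circle_points C" for C
  proof -
    have coc: "cocurvature C = 2 * Re (cnj w * center C) - curvature C * (cmod w)\<^sup>2"
      using that(1) unfolding Some_in_circle_points_iff by simp
    show ?thesis
      using that(2) unfolding Some_in_circle_points_iff coc normal_at_def cmod_square
      by (simp add: power2_eq_square algebra_simps)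
  qed
  have "curvature C * (cmod (v - w))\<^sup>2 = curvature C' * (cmod (v - w))\<^sup>2"
    using eq[OF assms(1)] eq[OF assms(2)] assms(3,5,6) Some by simp
  then show ?thesis using assms(4) Some by simp
qed

section \<open>Admissible pairs of a scaled normal and an integral curvature\<close>

locale circles_through_point = quadratic_point +
  fixes D :: nat
  assumes D_pos: "D > 0"
begin

abbreviation sd :: complex where "sd \<equiv> sqrt_disc K"
abbreviation N :: complex where "N \<equiv> \<alpha> * cnj \<alpha>"
abbreviation iD :: complex where "iD \<equiv> \<i> * of_real (sqrt (real D))"
abbreviation S :: real where "S \<equiv> sqrt (of_int \<bar>discriminant K\<bar>)"

lemma iD_nonzero: "iD \<noteq> 0" and S_pos: "S > 0"
  using D_pos discriminant_nonzero by auto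

text \<open>A circle of \<open>\<S>\<^sub>D\<close> through \<open>\<alpha>\<close> is encoded by its normal vector, scaled to \<open>\<eta>\<close>, and its integral
  curvature \<open>k\<close>. The two conditions are the integrality of the curvature-center and of the
  cocurvature.\<close>

definition admissible :: "complex \<Rightarrow> int \<Rightarrow> bool" where
  "admissible \<eta> k \<longleftrightarrow> \<eta> + sd * of_int k * \<alpha> \<in> \<O> \<and> alt_form \<eta> \<alpha> + of_int k * N \<in> \<int>"

lemma alt_form_times_sd: "alt_form v w * sd = v * cnj w - w * cnj v"
  using sqrt_disc_nonzero by (simp add: alt_form_def)

lemma alt_form_add: "alt_form (v + v') w = alt_form v w + alt_form v' w"
  by (simp add: alt_form_def add_divide_distrib diff_divide_distrib algebra_simps)

lemma alt_form_of_int: "alt_form (of_int k * v) w = of_int k * alt_form v w"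
  by (simp add: alt_form_def right_diff_distrib mult.assoc mult.left_commute)

text \<open>Conjugation negates \<open>sd\<close>, so the alternating difference becomes a trace.
  Against 1 this yields \<open>k\<close> times the trace of \<alpha>.\<close>

lemma alt_form_sd: "alt_form (sd * of_int k * v) w = of_int k * (v * cnj w + cnj v * w)"
  by (simp add: alt_form_def cnj_sqrt_disc sqrt_disc_nonzero field_simps)

text \<open>Both conditions are affine in \<open>k\<close>, so only the homogeneous ones matter for
  the difference. Pairing the first of these with 1 yields integrality of the trace multiple, and
  the second is that of the norm multiple.\<close>

lemma admissible_shift:
  assumes "admissible \<eta> k"
  shows "admissible \<eta> k' \<longleftrightarrow> n dvd k' - k"
proof -
  define j where "j = k' - k"
  have 1: "\<eta> + sd * of_int k' * \<alpha> = (\<eta> + sd * of_int k * \<alpha>) + sd * of_int j * \<alpha>"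
    by (simp add: j_def algebra_simps)
  have 2: "alt_form \<eta> \<alpha> + of_int k' * N = (alt_form \<eta> \<alpha> + of_int k * N) + of_int j * N"
    by (simp add: j_def algebra_simps)
  have a: "\<eta> + sd * of_int k * \<alpha> \<in> \<O>" "alt_form \<eta> \<alpha> + of_int k * N \<in> \<int>"
    using assms by (simp_all add: admissible_def)
  have "\<eta> + sd * of_int k' * \<alpha> \<in> \<O> \<longleftrightarrow> sd * of_int j * \<alpha> \<in> \<O>"
    unfolding 1 using a(1) O_add O_diff by (metis add_diff_cancel_left')
  moreover have "alt_form \<eta> \<alpha> + of_int k' * N \<in> \<int> \<longleftrightarrow> of_int j * N \<in> \<int>"
    unfolding 2 using a(2) Ints_add Ints_diff by (metis add_diff_cancel_left')
  ultimately have "admissible \<eta> k' \<longleftrightarrow> sd * of_int j * \<alpha> \<in> \<O> \<and> of_int j * N \<in> \<int>"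
    by (simp add: admissible_def)
  also have "\<dots> \<longleftrightarrow> n dvd j"
  proof
    assume j: "sd * of_int j * \<alpha> \<in> \<O> \<and> of_int j * N \<in> \<int>"
    then have "alt_form (sd * of_int j * \<alpha>) 1 \<in> \<int>" using alt_form_Ints O_one by blast
    then have "of_int j * (\<alpha> + cnj \<alpha>) \<in> \<int>" unfolding alt_form_sd by simp
    then show "n dvd j" using j denominator by blast
  next
    assume "n dvd j"
    then obtain i where i: "j = n * i" by (rule dvdE)
    have "sd * of_int j * \<alpha> = sd * of_int i * (of_int n * \<alpha>)" by (simp add: i)
    moreover have "sd * of_int i * (of_int n * \<alpha>) \<in> \<O>"
      by (rule O_mult[OF O_mult[OF sqrt_disc_O O_of_int] n_\<alpha>_O])
    ultimately have "sd * of_int j * \<alpha> \<in> \<O>" by (simp only:)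
    then show "sd * of_int j * \<alpha> \<in> \<O> \<and> of_int j * N \<in> \<int>"
      using denominator[of j] \<open>n dvd j\<close> by blast
  qed
  finally show ?thesis unfolding j_def .
qed

text \<open>The numbers 1, \<open>cnj \<alpha>\<close> and its square generate the square of the
  conjugate ideal; this is the conjugate form of the integrality of \<open>ideal_of\<close>.\<close>

definition integral_multiplier :: "complex \<Rightarrow> bool" where
  "integral_multiplier \<eta> \<longleftrightarrow> of_int n * \<eta> \<in> \<O> \<and> of_int n * (\<eta> * cnj \<alpha>) \<in> \<O> \<and>
     of_int n * (\<eta> * (cnj \<alpha> * cnj \<alpha>)) \<in> \<O>"

text \<open>One factor n clears the denominators of \<alpha> and \<open>N\<close>, which settles the
  first two products. The third contains the square of \<open>cnj \<alpha>\<close>; here the second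
  admissibility condition rewrites \<open>\<eta> * cnj \<alpha>\<close> as
  \<open>\<alpha> * cnj \<beta> + of_int k' * sd\<close>, and n suffices again.\<close>

lemma admissible_imp_integral_multiplier:
  assumes "admissible \<eta> k"
  shows "integral_multiplier \<eta>"
proof -
  define \<beta> where "\<beta> = \<eta> + sd * of_int k * \<alpha>"
  obtain k' where k': "alt_form \<eta> \<alpha> + of_int k * N = of_int k'"
    using assms by (auto simp: admissible_def elim: Ints_cases)
  have \<beta>: "\<beta> \<in> \<O>" using assms by (simp add: admissible_def \<beta>_def)
  have "of_int k' * sd = \<eta> * cnj \<alpha> - \<alpha> * cnj \<eta> + of_int k * N * sd"
    unfolding k'[symmetric] by (simp add: distrib_right alt_form_times_sd)
  then have *: "\<eta> * cnj \<alpha> = \<alpha> * cnj \<eta> - of_int k * N * sd + of_int k' * sd" by simp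
  have \<eta>: "\<eta> = \<beta> - sd * of_int k * \<alpha>" by (simp add: \<beta>_def)
  have cnj_\<eta>: "cnj \<eta> = cnj \<beta> + sd * of_int k * cnj \<alpha>" by (simp add: \<beta>_def cnj_sqrt_disc)
  have 1: "of_int n * \<eta> = of_int n * \<beta> - sd * of_int k * (of_int n * \<alpha>)"
    unfolding \<eta> by (simp add: algebra_simps)
  have 2: "of_int n * (\<eta> * cnj \<alpha>) = \<beta> * (of_int n * cnj \<alpha>) - sd * of_int k * (of_int n * N)"
    unfolding \<eta> by (simp add: algebra_simps)
  have "of_int n * (\<eta> * (cnj \<alpha> * cnj \<alpha>)) = of_int n * ((\<eta> * cnj \<alpha>) * cnj \<alpha>)" by simp
  also have "\<dots> = of_int n * N * cnj \<beta> + sd * of_int k' * (of_int n * cnj \<alpha>)"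
    unfolding * cnj_\<eta> by (simp add: algebra_simps)
  finally have 3: "of_int n * (\<eta> * (cnj \<alpha> * cnj \<alpha>)) = of_int n * N * cnj \<beta> + sd * of_int k' * (of_int n * cnj \<alpha>)" .
  show ?thesis
    unfolding integral_multiplier_def 1 2 3
    using \<beta> sqrt_disc_O n_\<alpha>_O n_cnj_\<alpha>_O n_norm_O by (simp only: O_closed simp_thms)
qed

text \<open>Modulo \<open>\<int>\<close>, admissibility forces \<open>k (\<alpha> + cnj \<alpha>) = - alt_form \<eta> 1\<close> and \<open>k N = - alt_form \<eta> \<alpha>\<close>;
  the Bezout relation then leaves only one candidate for \<open>k\<close> modulo \<open>n\<close>.\<close>

lemma integral_multiplier_imp_admissible:
  assumes "integral_multiplier \<eta>"
  shows "\<exists>k. admissible \<eta> k"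
proof -
  have \<eta>: "of_int n * \<eta> \<in> \<O>" "of_int n * (\<eta> * cnj \<alpha>) \<in> \<O>" "of_int n * (\<eta> * (cnj \<alpha> * cnj \<alpha>)) \<in> \<O>"
    using assms by (simp_all add: integral_multiplier_def)
  define A1 where "A1 = alt_form \<eta> 1"
  define A2 where "A2 = alt_form \<eta> \<alpha>"
  have A1: "of_int n * A1 \<in> \<int>"
    using alt_form_Ints[OF \<eta>(1) O_one] by (simp add: A1_def alt_form_of_int)
  have "alt_form (\<eta> * cnj \<alpha>) 1 = A2" by (simp add: A2_def alt_form_def mult.commute)
  then have A2: "of_int n * A2 \<in> \<int>"
    using alt_form_Ints[OF \<eta>(2) O_one] by (simp add: alt_form_of_int)
  obtain k1 k2 where k12: "of_int n * A1 = of_int k1" "of_int n * A2 = of_int k2"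
    using A1 A2 by (auto elim!: Ints_cases)
  \<comment> \<open>Multiply the Bezout relation by the unknown \<open>k\<close>. Modulo n this is y
    n times \<open>k\<close> times the trace plus z n times \<open>k * N\<close>, and the two
    congruences replace these by -\<open>A1\<close> and -\<open>A2\<close>.\<close>
  define k where "k = - (y * k1 + z * k2)"
  have "(of_int k :: complex) = - (of_int y * of_int k1 + of_int z * of_int k2)" by (simp add: k_def)
  then have k: "of_int k = - (of_int y * (of_int n * A1) + of_int z * (of_int n * A2))"
    unfolding k12 .
  have one: "1 = of_int x * of_int n + of_int y * (of_int n * (\<alpha> + cnj \<alpha>)) + of_int z * (of_int n * N)"
    unfolding trace norm using arg_cong[OF bezout, of "of_int :: int \<Rightarrow> complex"] by simp
  \<comment> \<open>Expanding \<open>B\<close> in this way attaches a factor n to it, so that the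
    terms can be matched with those of \<open>k\<close>.\<close>
  have bez: "B = of_int x * (of_int n * B) + of_int y * (of_int n * (B * (\<alpha> + cnj \<alpha>)))
      + of_int z * (of_int n * (B * N))" for B
  proof -
    have "B = B * (of_int x * of_int n + of_int y * (of_int n * (\<alpha> + cnj \<alpha>)) + of_int z * (of_int n * N))"
      unfolding one[symmetric] by simp
    then show ?thesis by (simp add: algebra_simps)
  qed
  have "A2 + of_int k * N \<in> \<int>"
  proof -
    have "A2 + of_int k * N = (of_int x * (of_int n * A2) + of_int y * (of_int n * (A2 * (\<alpha> + cnj \<alpha>)))
        + of_int z * (of_int n * (A2 * N))) - (of_int y * (of_int n * A1) + of_int z * (of_int n * A2)) * N"
      unfolding bez[of A2, symmetric] k by (simp add: algebra_simps)
    also have "\<dots> = of_int x * (of_int n * A2) + of_int y * (of_int n * (A2 * (\<alpha> + cnj \<alpha>) - A1 * N))"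
      by (simp add: algebra_simps)
    also have "A2 * (\<alpha> + cnj \<alpha>) - A1 * N = alt_form (\<eta> * (cnj \<alpha> * cnj \<alpha>)) 1"
      unfolding A1_def A2_def
      unfolding alt_form_def by (simp add: diff_divide_distrib add_divide_distrib algebra_simps)
    also have "of_int x * (of_int n * A2) + of_int y * (of_int n * alt_form (\<eta> * (cnj \<alpha> * cnj \<alpha>)) 1) \<in> \<int>"
      using A2 alt_form_Ints[OF \<eta>(3) O_one] unfolding alt_form_of_int
      by (rule Ints_add[OF Ints_mult[OF Ints_of_int] Ints_mult[OF Ints_of_int]])
    finally show ?thesis .
  qed
  moreover have "\<eta> + sd * of_int k * \<alpha> \<in> \<O>"
  proof (rule O_if_alt_form_Ints)
    fix \<xi> assume \<xi>: "\<xi> \<in> \<O>"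
    define B where "B = alt_form \<eta> \<xi>"
    define R where "R = \<alpha> * cnj \<xi> + cnj \<alpha> * \<xi>"
    have "alt_form (\<eta> + sd * of_int k * \<alpha>) \<xi> = B + of_int k * R"
      unfolding alt_form_add alt_form_sd B_def R_def ..
    also have "\<dots> = (of_int x * (of_int n * B) + of_int y * (of_int n * (B * (\<alpha> + cnj \<alpha>)))
        + of_int z * (of_int n * (B * N))) - (of_int y * (of_int n * A1) + of_int z * (of_int n * A2)) * R"
      unfolding bez[of B, symmetric] k by (simp add: algebra_simps)
    also have "\<dots> = of_int x * (of_int n * B) + of_int y * (of_int n * (B * (\<alpha> + cnj \<alpha>) - A1 * R))
        + of_int z * (of_int n * (B * N - A2 * R))"
      by (simp add: algebra_simps)
    \<comment> \<open>The separate terms need not be integral. This combination and the next one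
      are, because they factor through the second and the third product of
      \<open>integral_multiplier\<close>.\<close>
    also have "of_int n * (B * (\<alpha> + cnj \<alpha>) - A1 * R)
        = - (alt_form \<xi> 1 * (of_int n * (\<eta> * cnj \<alpha>) + cnj (of_int n * (\<eta> * cnj \<alpha>))))"
      unfolding A1_def B_def R_def alt_form_def
      by (simp add: diff_divide_distrib add_divide_distrib algebra_simps)
    also have "of_int n * (B * N - A2 * R) = - alt_form (of_int n * (\<eta> * (cnj \<alpha> * cnj \<alpha>)) * \<xi>) 1"
      unfolding A2_def B_def R_def alt_form_def
      by (simp add: diff_divide_distrib add_divide_distrib algebra_simps)
    finally have eq: "alt_form (\<eta> + sd * of_int k * \<alpha>) \<xi> = of_int x * (of_int n * B) +
        of_int y * - (alt_form \<xi> 1 * (of_int n * (\<eta> * cnj \<alpha>) + cnj (of_int n * (\<eta> * cnj \<alpha>)))) +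
        of_int z * - alt_form (of_int n * (\<eta> * (cnj \<alpha> * cnj \<alpha>)) * \<xi>) 1" .
    have "of_int n * B \<in> \<int>"
      using alt_form_Ints[OF \<eta>(1) \<xi>] by (simp add: B_def alt_form_of_int)
    moreover have "alt_form \<xi> 1 * (of_int n * (\<eta> * cnj \<alpha>) + cnj (of_int n * (\<eta> * cnj \<alpha>))) \<in> \<int>"
      using alt_form_Ints[OF \<xi> O_one] \<eta>(2) unfolding integers_iff by (intro Ints_mult) auto
    moreover have "alt_form (of_int n * (\<eta> * (cnj \<alpha> * cnj \<alpha>)) * \<xi>) 1 \<in> \<int>"
      by (intro alt_form_Ints O_mult[OF \<eta>(3) \<xi>] O_one)
    ultimately show "alt_form (\<eta> + sd * of_int k * \<alpha>) \<xi> \<in> \<int>"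
      unfolding eq
      by (rule Ints_add[OF Ints_add[OF Ints_mult[OF Ints_of_int] Ints_mult[OF Ints_of_int Ints_minus]]
            Ints_mult[OF Ints_of_int Ints_minus]])
  qed
  ultimately show ?thesis unfolding admissible_def A2_def by blast
qed

section \<open>From scaled normals to ideals\<close>

text \<open>The factor n compensates the norm of \<open>\<AA>\<AA>\<close>, which is the inverse
  square of n, so that the norm of the ideal is the squared modulus of \<eta>.\<close>

definition ideal_of :: "complex \<Rightarrow> complex set" where
  "ideal_of \<eta> = (of_int n * cnj \<eta>) *o \<AA>\<AA>"

lemma integral_multiplier_iff: "integral_multiplier \<eta> \<longleftrightarrow> ideal_of \<eta> \<subseteq> \<O>"
proof
  assume *: "integral_multiplier \<eta>"
  let ?c = "of_int n * cnj \<eta>"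
  have "cnj (of_int n * \<eta>) \<in> \<O>" "cnj (of_int n * (\<eta> * cnj \<alpha>)) \<in> \<O>"
    "cnj (of_int n * (\<eta> * (cnj \<alpha> * cnj \<alpha>))) \<in> \<O>"
    using * unfolding integral_multiplier_def by (simp_all only: O_cnj)
  then have c: "?c \<in> \<O>" "?c * \<alpha> \<in> \<O>" "?c * (\<alpha> * \<alpha>) \<in> \<O>" by (simp_all add: mult.assoc)
  show "ideal_of \<eta> \<subseteq> \<O>"
  proof
    fix w assume "w \<in> ideal_of \<eta>"
    then obtain p q r where pq: "p \<in> \<O>" "q \<in> \<O>" "r \<in> \<O>" "w = ?c * (p + q * \<alpha> + r * (\<alpha> * \<alpha>))"
      by (auto simp: ideal_of_def elt_set_times_def \<AA>\<AA>_iff)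
    have "w = ?c * p + (?c * \<alpha>) * q + (?c * (\<alpha> * \<alpha>)) * r" by (simp add: pq algebra_simps)
    also have "\<dots> \<in> \<O>" by (intro O_add O_mult[OF c(1) pq(1)] O_mult[OF c(2) pq(2)] O_mult[OF c(3) pq(3)])
    finally show "w \<in> \<O>" .
  qed
next
  assume "ideal_of \<eta> \<subseteq> \<O>"
  moreover have "(of_int n * cnj \<eta>) * 1 \<in> ideal_of \<eta>" "(of_int n * cnj \<eta>) * \<alpha> \<in> ideal_of \<eta>"
    "(of_int n * cnj \<eta>) * (\<alpha> * \<alpha>) \<in> ideal_of \<eta>"
    unfolding ideal_of_def using \<AA>\<AA>_basis by blast+
  ultimately have "cnj ((of_int n * cnj \<eta>) * 1) \<in> \<O>" "cnj ((of_int n * cnj \<eta>) * \<alpha>) \<in> \<O>"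
    "cnj ((of_int n * cnj \<eta>) * (\<alpha> * \<alpha>)) \<in> \<O>" using O_cnj by blast+
  then show "integral_multiplier \<eta>" by (simp add: integral_multiplier_def mult.assoc)
qed

lemma integral_multiplier_K: "integral_multiplier \<eta> \<Longrightarrow> \<eta> \<in> K"
proof -
  assume "integral_multiplier \<eta>"
  then have "of_int n * \<eta> \<in> K" using O_subset_K by (simp add: integral_multiplier_def)
  then have "of_int n * \<eta> / of_int n \<in> K" by (rule K_divide[OF _ K_Rats[OF Rats_of_int]])
  then show "\<eta> \<in> K" using n_nonzero by simp
qed

text \<open>Equality of the ideals makes the conjugate quotient a multiplier of
  \<open>\<AA>\<AA>\<close>, and all such multipliers are integral. Conversely, a quotient of
  modulus 1 has its conjugate as inverse, so it is a unit once it is integral.\<close>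

lemma ideal_of_eq_iff:
  assumes "cmod \<eta> = cmod \<eta>'" "\<eta> \<noteq> 0"
  shows "ideal_of \<eta> = ideal_of \<eta>' \<longleftrightarrow> \<eta> / \<eta>' \<in> \<O>"
proof -
  have "\<eta>' \<noteq> 0" using assms by auto
  have stable: "w * s \<in> \<AA>\<AA>" if "ideal_of \<eta> = ideal_of \<eta>'" "w = cnj (\<eta> / \<eta>')" "s \<in> \<AA>\<AA>" for w s
  proof -
    have "(of_int n * cnj \<eta>) * s \<in> ideal_of \<eta>'" using that unfolding that(1)[symmetric] ideal_of_def by blast
    then obtain r where "r \<in> \<AA>\<AA>" "(of_int n * cnj \<eta>) * s = (of_int n * cnj \<eta>') * r"
      by (auto simp: ideal_of_def elt_set_times_def)
    moreover have "r = w * s"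
    proof -
      have "cnj \<eta> = cnj \<eta>' * w" using that(2) \<open>\<eta>' \<noteq> 0\<close> by simp
      then have "(of_int n * cnj \<eta>') * (w * s) = (of_int n * cnj \<eta>') * r"
        using calculation(2) by (simp add: mult_ac)
      then show ?thesis using \<open>\<eta>' \<noteq> 0\<close> n_nonzero by simp
    qed
    ultimately show ?thesis by simp
  qed
  have sub: "ideal_of \<eta> \<subseteq> ideal_of \<eta>'" if "\<eta> / \<eta>' \<in> \<O>" "\<eta>' \<noteq> 0" for \<eta> \<eta>'
  proof
    fix w assume "w \<in> ideal_of \<eta>"
    then obtain s where s: "s \<in> \<AA>\<AA>" "w = (of_int n * cnj \<eta>) * s"
      by (auto simp: ideal_of_def elt_set_times_def)
    have "w = (of_int n * cnj \<eta>') * (cnj (\<eta> / \<eta>') * s)" using that(2) by (simp add: s)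
    also have "\<dots> \<in> ideal_of \<eta>'"
      unfolding ideal_of_def by (intro set_times_intro2 \<AA>\<AA>_O_mult O_cnj that s)
    finally show "w \<in> ideal_of \<eta>'" .
  qed
  show ?thesis
  proof
    assume "ideal_of \<eta> = ideal_of \<eta>'"
    then have "cnj (\<eta> / \<eta>') \<in> \<O>" using stable by (intro O_if_\<AA>\<AA>_stable) blast
    then have "cnj (cnj (\<eta> / \<eta>')) \<in> \<O>" by (rule O_cnj)
    then show "\<eta> / \<eta>' \<in> \<O>" by simp
  next
    assume *: "\<eta> / \<eta>' \<in> \<O>"
    have "\<eta> * cnj \<eta> = \<eta>' * cnj \<eta>'" using assms(1) by (simp flip: complex_norm_square)
    then have "\<eta>' / \<eta> = cnj (\<eta> / \<eta>')" using assms(2) \<open>\<eta>' \<noteq> 0\<close> by (simp add: field_simps)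
    then have "\<eta>' / \<eta> \<in> \<O>" using O_cnj[OF *] by simp
    then show "ideal_of \<eta> = ideal_of \<eta>'" using sub * assms(2) \<open>\<eta>' \<noteq> 0\<close> by blast
  qed
qed

end


section \<open>Families of circles through a point\<close>

context circles_through_point
begin

section \<open>Circles through \<alpha> as admissible pairs\<close>

definition through :: "circle set" where
  "through = {C \<in> circles K D. Some \<alpha> \<in> circle_points C}"

definition eta :: "circle \<Rightarrow> complex" where
  "eta C = iD * normal_at C \<alpha>"

lemma throughD:
  assumes "C \<in> through"
  shows "C \<in> circles K D" "Some \<alpha> \<in> circle_points C" "oriented_circle C"
  using assms by (auto simp: through_def circles_def)

lemma cmod_normal: "C \<in> through \<Longrightarrow> cmod (normal_at C \<alpha>) = 1"
  using cmod_normal_at[OF throughD(2)] throughD(3) by blast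

lemma cmod_eta: "C \<in> through \<Longrightarrow> (cmod (eta C))\<^sup>2 = real D"
  by (simp add: eta_def norm_mult cmod_normal)

lemma eta_nonzero: "C \<in> through \<Longrightarrow> eta C \<noteq> 0"
  using cmod_eta[of C] D_pos by auto

lemma eta_eq_iff: "eta C = eta C' \<longleftrightarrow> normal_at C \<alpha> = normal_at C' \<alpha>"
  using iD_nonzero by (simp add: eta_def)

lemma eta_divide: "eta C / eta C' = normal_at C \<alpha> / normal_at C' \<alpha>"
  using iD_nonzero by (simp add: eta_def)

lemma mem_sd_Ints_iff: "v * sd \<in> sd *o \<int> \<longleftrightarrow> v \<in> \<int>"
  using sqrt_disc_nonzero by (auto simp: elt_set_times_def)

text \<open>The curvature condition produces \<open>k\<close>. The equation of the circle at
  \<alpha> then expresses the other coordinates through \<open>eta C\<close> and \<open>k\<close>,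
  which turns their integrality into \<open>admissible\<close>.\<close>

lemma through_iff:
  assumes "Some \<alpha> \<in> circle_points C" "oriented_circle C"
  shows "C \<in> through \<longleftrightarrow> (\<exists>k. sqrt (real D) * curvature C = S * of_int k \<and> admissible (eta C) k)"
proof -
  let ?r = "curvature C" let ?\<beta> = "iD * center C"
  have curv: "iD * of_real ?r \<in> sd *o \<int> \<longleftrightarrow> (\<exists>k. sqrt (real D) * ?r = S * of_int k)"
  proof -
    have "iD * of_real ?r = sd * of_int k \<longleftrightarrow> sqrt (real D) * ?r = S * of_int k" for k
    proof -
      have "iD * of_real ?r = \<i> * of_real (sqrt (real D) * ?r)" "sd * of_int k = \<i> * of_real (S * of_int k)"
        by (simp_all add: sqrt_disc_def)
      then show ?thesis by (metis complex_i_not_zero mult_left_cancel of_real_eq_iff)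
    qed
    then show ?thesis by (auto simp: elt_set_times_def Ints_def)
  qed
  have cond: "?\<beta> = eta C + sd * of_int k * \<alpha>"
    "iD * of_real (cocurvature C) = (alt_form (eta C) \<alpha> + of_int k * N) * sd"
    if "sqrt (real D) * ?r = S * of_int k" for k
  proof -
    have "iD * of_real ?r = \<i> * of_real (sqrt (real D) * ?r)" by simp
    also have "\<dots> = sd * of_int k" unfolding that by (simp add: sqrt_disc_def)
    finally have r: "iD * of_real ?r = sd * of_int k" .
    show \<beta>: "?\<beta> = eta C + sd * of_int k * \<alpha>"
      unfolding r[symmetric] by (simp add: eta_def normal_at_def algebra_simps)
    have "cocurvature C = 2 * Re (cnj \<alpha> * center C) - ?r * (cmod \<alpha>)\<^sup>2"
      using assms(1) unfolding Some_in_circle_points_iff by simp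
    then have "of_real (cocurvature C) = cnj \<alpha> * center C + cnj (cnj \<alpha> * center C) - of_real ?r * N"
      unfolding complex_add_cnj by (simp flip: complex_norm_square)
    then have "iD * of_real (cocurvature C)
        = iD * (cnj \<alpha> * center C + cnj (cnj \<alpha> * center C) - of_real ?r * N)" by (simp only:)
    \<comment> \<open>As \<open>iD\<close> is purely imaginary, multiplying by it turns a sum of
      conjugates into a difference; this is the source of \<open>alt_form\<close>.\<close>
    also have "\<dots> = cnj \<alpha> * ?\<beta> - \<alpha> * cnj ?\<beta> - (iD * of_real ?r) * N"
      by (simp add: algebra_simps)
    also have "\<dots> = (alt_form (eta C) \<alpha> + of_int k * N) * sd"
      unfolding r \<beta> distrib_right alt_form_times_sd
      by (simp add: cnj_sqrt_disc algebra_simps)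
    finally show "iD * of_real (cocurvature C) = (alt_form (eta C) \<alpha> + of_int k * N) * sd" .
  qed
  have "iD * cnj (center C) \<in> \<O> \<longleftrightarrow> ?\<beta> \<in> \<O>"
  proof -
    have "iD * cnj (center C) = - cnj ?\<beta>" by simp
    then show ?thesis using O_minus O_cnj by (metis complex_cnj_cnj minus_minus)
  qed
  then have "C \<in> through \<longleftrightarrow> ?\<beta> \<in> \<O> \<and> iD * of_real (cocurvature C) \<in> sd *o \<int> \<and> iD * of_real ?r \<in> sd *o \<int>"
    using assms unfolding through_def circles_def Let_def circle_vec_def
    by (auto simp: vector_4)
  also have "\<dots> \<longleftrightarrow> (\<exists>k. sqrt (real D) * ?r = S * of_int k \<and> admissible (eta C) k)"
    unfolding curv using cond mem_sd_Ints_iff unfolding admissible_def by metis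
  finally show ?thesis .
qed

lemma obtain_admissible:
  assumes "C \<in> through"
  obtains k where "sqrt (real D) * curvature C = S * of_int k" "admissible (eta C) k"
  using assms through_iff throughD by blast

lemma admissible_imp_circle:
  assumes "(cmod \<eta>)\<^sup>2 = real D" "admissible \<eta> k"
  obtains C where "C \<in> through" "eta C = \<eta>" "sqrt (real D) * curvature C = S * of_int k"
proof -
  define r where "r = S * of_int k / sqrt (real D)"
  define \<zeta> where "\<zeta> = \<eta> / iD + of_real r * \<alpha>"
  \<comment> \<open>The cocurvature is the value forced by passing through \<alpha>.\<close>
  define C where "C = Circle \<zeta> r (2 * Re (cnj \<alpha> * \<zeta>) - r * (cmod \<alpha>)\<^sup>2)"
  have p: "Some \<alpha> \<in> circle_points C" by (simp add: Some_in_circle_points_iff C_def)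
  have normal: "normal_at C \<alpha> = \<eta> / iD" by (simp add: normal_at_def C_def \<zeta>_def)
  then have \<eta>: "eta C = \<eta>" using iD_nonzero by (simp add: eta_def)
  have r: "sqrt (real D) * curvature C = S * of_int k" using D_pos by (simp add: C_def r_def)
  have "cmod \<eta> = sqrt (real D)" using assms(1) by (metis norm_ge_zero real_sqrt_unique)
  then have "cmod (normal_at C \<alpha>) = 1" unfolding normal using D_pos by (simp add: norm_divide norm_mult)
  then have "oriented_circle C" using cmod_normal_at[OF p] by simp
  then show ?thesis using that[OF _ \<eta> r] through_iff[OF p] r \<eta> assms(2) by blast
qed

lemma ideal_of_eta_eq_iff:
  assumes "C \<in> through" "C' \<in> through"
  shows "ideal_of (eta C) = ideal_of (eta C') \<longleftrightarrow> eta C / eta C' \<in> \<O>"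
proof (rule ideal_of_eq_iff[OF _ eta_nonzero[OF assms(1)]])
  show "cmod (eta C) = cmod (eta C')"
    using cmod_eta[OF assms(1)] cmod_eta[OF assms(2)]
    by (metis norm_ge_zero power2_eq_iff_nonneg)
qed

text \<open>The unoriented angle determines the quotient of the scaled normals only up to
  conjugation, under which \<open>\<O>\<close> is stable.\<close>

lemma cis_circle_angle_iff:
  assumes "C \<in> through" "C' \<in> through"
  shows "cis (circle_angle C C') \<in> \<O> \<longleftrightarrow> ideal_of (eta C) = ideal_of (eta C')"
proof -
  let ?g = "eta C / eta C'"
  have "cmod ?g = 1"
    unfolding eta_divide by (simp add: norm_divide cmod_normal assms)
  moreover have "circle_angle C C' = \<bar>Arg ?g\<bar>"
    unfolding eta_divide using assms by (intro circle_angle_through_point throughD)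
  ultimately have "cis (circle_angle C C') = ?g \<or> cis (circle_angle C C') = cnj ?g"
    using cis_abs_Arg_unit by metis
  then have "cis (circle_angle C C') \<in> \<O> \<longleftrightarrow> ?g \<in> \<O>"
    using O_cnj by (metis complex_cnj_cnj)
  then show ?thesis unfolding ideal_of_eta_eq_iff[OF assms] .
qed

section \<open>The correspondence of extended families and ideals\<close>

definition extended_family_of :: "complex set \<Rightarrow> circle set" where
  "extended_family_of I = {C \<in> through. ideal_of (eta C) = I}"

abbreviation meet_in_integral_angles :: "circle set \<Rightarrow> bool" where
  "meet_in_integral_angles F \<equiv> F \<noteq> {} \<and> F \<subseteq> circles K D \<and>
     (\<exists>z. \<forall>C \<in> F. \<forall>C' \<in> F. z \<in> circle_points C \<inter> circle_points C' \<and>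
        cis (circle_angle C C') \<in> \<O>)"

lemma meet_in_integral_angles_extended_family_of:
  assumes "C0 \<in> through"
  shows "meet_in_integral_angles (extended_family_of (ideal_of (eta C0)))"
proof (intro conjI exI[of _ "Some \<alpha>"] ballI)
  let ?F = "extended_family_of (ideal_of (eta C0))"
  show "?F \<noteq> {}" using assms by (auto simp: extended_family_of_def)
  show "?F \<subseteq> circles K D" by (auto simp: extended_family_of_def through_def)
  fix C C' assume "C \<in> ?F" "C' \<in> ?F"
  then have C: "C \<in> through" "C' \<in> through" "ideal_of (eta C) = ideal_of (eta C')"
    by (auto simp: extended_family_of_def)
  show "Some \<alpha> \<in> circle_points C \<inter> circle_points C'" using C throughD(2) by blast
  show "cis (circle_angle C C') \<in> \<O>" using C(3) cis_circle_angle_iff[OF C(1,2)] by blast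
qed

text \<open>The common point of an extended family is determined by it, because it contains two
  tangent circles.\<close>

lemma is_extended_family_of:
  assumes "C0 \<in> through"
  shows "is_extended_family K D (extended_family_of (ideal_of (eta C0)))"
  unfolding is_extended_family_def maximal_set_def
proof (intro conjI[OF meet_in_integral_angles_extended_family_of[OF assms]] allI impI)
  let ?F = "extended_family_of (ideal_of (eta C0))"
  fix G assume G: "meet_in_integral_angles G \<and> ?F \<subseteq> G"
  then obtain p where p: "\<And>C C'. C \<in> G \<Longrightarrow> C' \<in> G \<Longrightarrow>
      p \<in> circle_points C \<inter> circle_points C' \<and> cis (circle_angle C C') \<in> \<O>" by blast
  obtain k where k: "sqrt (real D) * curvature C0 = S * of_int k" "admissible (eta C0) k"
    by (rule obtain_admissible[OF assms])
  \<comment> \<open>The next admissible curvature gives a second circle, tangent to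
    \<open>C0\<close> at \<alpha>. It pins the common point \<open>p\<close> of \<open>G\<close> to
    \<alpha>.\<close>
  then have "admissible (eta C0) (k + n)" by (simp add: admissible_shift[OF k(2)])
  then obtain C1 where C1: "C1 \<in> through" "eta C1 = eta C0" "sqrt (real D) * curvature C1 = S * of_int (k + n)"
    by (rule admissible_imp_circle[OF cmod_eta[OF assms]])
  have "S * of_int k \<noteq> S * of_int (k + n)" using S_pos n_pos by simp
  then have "curvature C0 \<noteq> curvature C1" using k(1) C1(3) by metis
  moreover have "C0 \<in> G" "C1 \<in> G" using G assms C1 by (auto simp: extended_family_of_def)
  moreover from this have "p \<in> circle_points C0" "p \<in> circle_points C1" using p by auto
  ultimately have p\<alpha>: "p = Some \<alpha>"
    using tangent_circles_meet_once[OF throughD(2)[OF assms] throughD(2)[OF C1(1)]] C1(2)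
    unfolding eta_eq_iff by metis
  have "G \<subseteq> ?F"
  proof
    fix C assume "C \<in> G"
    then have "C \<in> through" using p[of C C] G p\<alpha> by (auto simp: through_def)
    moreover have "cis (circle_angle C C0) \<in> \<O>" using p \<open>C \<in> G\<close> \<open>C0 \<in> G\<close> by blast
    ultimately show "C \<in> ?F" using cis_circle_angle_iff assms by (simp add: extended_family_of_def)
  qed
  then show "G = ?F" using G by blast
qed

text \<open>All members of \<open>E\<close> have the same ideal as \<open>C0\<close>, so
  \<open>E\<close> lies in the full set of circles with that ideal. This set also meets in integral
  angles, and maximality gives equality.\<close>

lemma extended_family_eq:
  assumes "is_extended_family K D E" "passes_through E \<alpha>" "C0 \<in> E"
  shows "C0 \<in> through" "E = extended_family_of (ideal_of (eta C0))"
proof -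
  have E: "meet_in_integral_angles E"
    and max: "\<And>G. meet_in_integral_angles G \<Longrightarrow> E \<subseteq> G \<Longrightarrow> G = E"
    using assms(1) unfolding is_extended_family_def maximal_set_def by blast+
  have sub: "E \<subseteq> through" using E assms(2) by (auto simp: through_def passes_through_def)
  then show C0: "C0 \<in> through" using assms(3) by blast
  have "E \<subseteq> extended_family_of (ideal_of (eta C0))"
  proof
    fix C assume "C \<in> E"
    then have "cis (circle_angle C C0) \<in> \<O>" using E assms(3) by blast
    then show "C \<in> extended_family_of (ideal_of (eta C0))"
      using cis_circle_angle_iff[OF _ C0] sub \<open>C \<in> E\<close> by (auto simp: extended_family_of_def)
  qed
  then show "E = extended_family_of (ideal_of (eta C0))"
    using max[OF meet_in_integral_angles_extended_family_of[OF C0]] by simp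
qed

text \<open>The choice of the circle is immaterial by \<open>family_ideal_eq\<close>.\<close>

definition family_ideal :: "circle set \<Rightarrow> complex set" where
  "family_ideal E = ideal_of (eta (SOME C. C \<in> E))"

lemma family_ideal_eq:
  assumes "is_extended_family K D E" "passes_through E \<alpha>" "C \<in> E"
  shows "family_ideal E = ideal_of (eta C)"
proof -
  have "(SOME C. C \<in> E) \<in> E" using assms(3) by (rule someI)
  then show ?thesis
    using extended_family_eq(2)[OF assms] by (auto simp: family_ideal_def extended_family_of_def)
qed

lemma extended_family_nonempty:
  assumes "is_extended_family K D E"
  obtains C where "C \<in> E"
  using assms unfolding is_extended_family_def maximal_set_def by blast

lemma ideal_of_eta_properties:
  assumes "C \<in> through"
  shows "integral_ideal K (ideal_of (eta C))" "ideal_norm K (ideal_of (eta C)) = real D"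
    "ideal_of (eta C) \<in> ideal_class K \<AA>\<AA>"
proof -
  obtain k where "admissible (eta C) k" by (rule obtain_admissible[OF assms])
  then have mult: "integral_multiplier (eta C)" by (rule admissible_imp_integral_multiplier)
  let ?c = "of_int n * cnj (eta C)"
  have c: "?c \<in> K" "?c \<noteq> 0"
    using integral_multiplier_K[OF mult] eta_nonzero[OF assms] n_nonzero
    by (auto intro!: K_mult K_cnj K_Rats[OF Rats_of_int])
  have sub: "?c *o \<AA>\<AA> \<subseteq> \<O>" using mult integral_multiplier_iff by (simp add: ideal_of_def)
  show int: "integral_ideal K (ideal_of (eta C))"
    unfolding ideal_of_def by (rule scaled_\<AA>\<AA>_integral_ideal[OF c(2) sub])
  show "ideal_norm K (ideal_of (eta C)) = real D"
    unfolding ideal_of_def ideal_norm_scaled_\<AA>\<AA>[OF c sub]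
    using n_pos by (simp add: norm_mult power_mult_distrib cmod_eta[OF assms])
  show "ideal_of (eta C) \<in> ideal_class K \<AA>\<AA>"
    unfolding ideal_class_def using integral_ideal_imp_fractional[OF int] c
    by (auto simp: ideal_of_def)
qed

lemma ideal_in_class_imp_circle:
  assumes "integral_ideal K I" "ideal_norm K I = real D" "I \<in> ideal_class K \<AA>\<AA>"
  obtains C where "C \<in> through" "ideal_of (eta C) = I"
proof -
  obtain c where c: "c \<in> K" "c \<noteq> 0" "I = c *o \<AA>\<AA>"
    using assms(3) by (auto simp: ideal_class_def)
  \<comment> \<open>This inverts \<open>ideal_of\<close>; the norm condition on the ideal then
    becomes the required modulus of \<eta>.\<close>
  define \<eta> where "\<eta> = cnj (c / of_int n)"
  have I: "ideal_of \<eta> = I" using n_nonzero by (simp add: ideal_of_def \<eta>_def c(3))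
  have "ideal_of \<eta> \<subseteq> \<O>" unfolding I by (rule integral_ideal_subset[OF assms(1)])
  then obtain k where k: "admissible \<eta> k"
    using integral_multiplier_iff integral_multiplier_imp_admissible by blast
  have "c *o \<AA>\<AA> \<subseteq> \<O>" using integral_ideal_subset[OF assms(1)] c(3) by simp
  then have "(cmod c)\<^sup>2 / (of_int n)\<^sup>2 = real D"
    using ideal_norm_scaled_\<AA>\<AA>[OF c(1,2)] assms(2) c(3) by simp
  then have "(cmod \<eta>)\<^sup>2 = real D" by (simp add: \<eta>_def norm_divide power_divide)
  then show ?thesis using admissible_imp_circle[OF _ k] that I by metis
qed

lemma bij_betw_family_ideal:
  "bij_betw family_ideal {E. is_extended_family K D E \<and> passes_through E \<alpha>}
     {I. integral_ideal K I \<and> ideal_norm K I = real D \<and> I \<in> ideal_class K \<AA>\<AA>}"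
proof (rule bij_betw_byWitness[where f' = extended_family_of])
  show "\<forall>E\<in>{E. is_extended_family K D E \<and> passes_through E \<alpha>}. extended_family_of (family_ideal E) = E"
  proof clarify
    fix E assume E: "is_extended_family K D E" "passes_through E \<alpha>"
    obtain C where "C \<in> E" by (rule extended_family_nonempty[OF E(1)])
    then show "extended_family_of (family_ideal E) = E"
      using extended_family_eq[OF E] family_ideal_eq[OF E] by metis
  qed
  have *: "is_extended_family K D (extended_family_of I)" "passes_through (extended_family_of I) \<alpha>"
    "family_ideal (extended_family_of I) = I"
    if I: "integral_ideal K I" "ideal_norm K I = real D" "I \<in> ideal_class K \<AA>\<AA>" for I
  proof -
    obtain C where C: "C \<in> through" "ideal_of (eta C) = I"
      by (rule ideal_in_class_imp_circle[OF I])
    show 1: "is_extended_family K D (extended_family_of I)"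
      using is_extended_family_of[OF C(1)] C(2) by simp
    show 2: "passes_through (extended_family_of I) \<alpha>"
      by (auto simp: passes_through_def extended_family_of_def through_def)
    have "C \<in> extended_family_of I" using C by (simp add: extended_family_of_def)
    then show "family_ideal (extended_family_of I) = I" using family_ideal_eq[OF 1 2] C(2) by simp
  qed
  then show "\<forall>I\<in>{I. integral_ideal K I \<and> ideal_norm K I = real D \<and> I \<in> ideal_class K \<AA>\<AA>}.
      family_ideal (extended_family_of I) = I" by blast
  show "extended_family_of ` {I. integral_ideal K I \<and> ideal_norm K I = real D \<and> I \<in> ideal_class K \<AA>\<AA>}
      \<subseteq> {E. is_extended_family K D E \<and> passes_through E \<alpha>}"
    using * by blast
  show "family_ideal ` {E. is_extended_family K D E \<and> passes_through E \<alpha>}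
      \<subseteq> {I. integral_ideal K I \<and> ideal_norm K I = real D \<and> I \<in> ideal_class K \<AA>\<AA>}"
  proof clarify
    fix E assume E: "is_extended_family K D E" "passes_through E \<alpha>"
    obtain C where C: "C \<in> E" by (rule extended_family_nonempty[OF E(1)])
    show "integral_ideal K (family_ideal E) \<and> ideal_norm K (family_ideal E) = real D \<and>
        family_ideal E \<in> ideal_class K \<AA>\<AA>"
      unfolding family_ideal_eq[OF E C]
      using ideal_of_eta_properties[OF extended_family_eq(1)[OF E C]] by blast
  qed
qed

text \<open>The square of \<open>\<AA>\<close> and the factor n cancel in the quotient of the
  ideals, leaving the quotient of the conjugate scaled normals as a generator.\<close>

lemma circle_angle_generator:
  assumes E: "is_extended_family K D E" "passes_through E \<alpha>" "C \<in> E"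
    and E': "is_extended_family K D E'" "passes_through E' \<alpha>" "C' \<in> E'"
  shows "\<exists>g. is_generator K g (ideal_quotient K (family_ideal E) (family_ideal E')) \<and>
    circle_angle C C' = \<bar>Arg g\<bar>"
proof -
  have C: "C \<in> through" "C' \<in> through" using extended_family_eq(1) E E' by blast+
  have K: "of_int n * cnj (eta C) \<in> K" if C: "C \<in> through" for C
  proof -
    obtain k where "admissible (eta C) k" by (rule obtain_admissible[OF C])
    then have "eta C \<in> K" by (intro integral_multiplier_K admissible_imp_integral_multiplier)
    then show ?thesis by (rule K_mult[OF K_Rats[OF Rats_of_int] K_cnj])
  qed
  let ?g = "cnj (eta C) / cnj (eta C')"
  have "ideal_quotient K (family_ideal E) (family_ideal E')
      = (of_int n * cnj (eta C) / (of_int n * cnj (eta C'))) *o \<O>"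
    unfolding family_ideal_eq[OF E] family_ideal_eq[OF E'] ideal_of_def
    using K C eta_nonzero n_nonzero by (intro ideal_quotient_scaled_\<AA>\<AA>) auto
  then have "is_generator K ?g (ideal_quotient K (family_ideal E) (family_ideal E'))"
    using n_nonzero by (simp add: is_generator_def)
  moreover have "circle_angle C C' = \<bar>Arg (cnj (normal_at C \<alpha>) / cnj (normal_at C' \<alpha>))\<bar>"
    using C by (intro circle_angle_through_point throughD)
  moreover have "cnj (normal_at C \<alpha>) / cnj (normal_at C' \<alpha>) = ?g"
    using eta_divide[of C C'] by (metis complex_cnj_divide)
  ultimately show ?thesis by (intro exI[of _ ?g]) simp
qed

text \<open>Tangency at \<alpha> means equal \<open>eta\<close>, and maximality puts all circles
  with that \<open>eta\<close> into \<open>F\<close>. Their scaled curvatures are the admissible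
  integers \<open>k\<close>, a class modulo n, and n is the inverse norm of
  \<open>\<AA>\<close>.\<close>

lemma family_curvatures:
  assumes F: "is_family K D F" "passes_through F \<alpha>"
  shows "\<exists>x. (\<lambda>C. sqrt (real D / of_int \<bar>discriminant K\<bar>) * curvature C) ` F =
             {x + of_int k * (1 / ideal_norm K \<AA>) |k. True}"
proof -
  have nonempty: "F \<noteq> {}" and sub: "F \<subseteq> through"
    and one: "\<And>C C'. C \<in> F \<Longrightarrow> C' \<in> F \<Longrightarrow> inner_Q (circle_vec C) (circle_vec C') = 1"
    and max: "\<And>G. G \<noteq> {} \<Longrightarrow> G \<subseteq> circles K D \<Longrightarrow>
      (\<forall>C\<in>G. \<forall>C'\<in>G. inner_Q (circle_vec C) (circle_vec C') = 1) \<Longrightarrow> F \<subseteq> G \<Longrightarrow> G = F"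
    using F unfolding is_family_def maximal_set_def passes_through_def through_def by blast+
  obtain C0 where C0: "C0 \<in> F" using nonempty by blast
  then have C0': "C0 \<in> through" using sub by blast
  let ?G = "{C \<in> through. eta C = eta C0}"
  have iff: "inner_Q (circle_vec C) (circle_vec C') = 1 \<longleftrightarrow> eta C = eta C'"
    if "C \<in> through" "C' \<in> through" for C C'
    unfolding eta_eq_iff using that by (intro inner_Q_eq_1_iff throughD)
  have G: "?G = F"
  proof (rule max)
    show "?G \<noteq> {}" using C0' by blast
    show "?G \<subseteq> circles K D" by (auto simp: through_def)
    show "\<forall>C\<in>?G. \<forall>C'\<in>?G. inner_Q (circle_vec C) (circle_vec C') = 1" using iff by auto
    show "F \<subseteq> ?G"
    proof
      fix C assume "C \<in> F"
      then show "C \<in> ?G" using one[OF _ C0] iff[OF _ C0'] sub by blast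
    qed
  qed
  obtain k where k: "sqrt (real D) * curvature C0 = S * of_int k" "admissible (eta C0) k"
    by (rule obtain_admissible[OF C0'])
  have scaled: "sqrt (real D / of_int \<bar>discriminant K\<bar>) * curvature C = of_int j \<longleftrightarrow>
      sqrt (real D) * curvature C = S * of_int j" for C j
    using S_pos by (simp add: real_sqrt_divide field_simps)
  have "(\<lambda>C. sqrt (real D / of_int \<bar>discriminant K\<bar>) * curvature C) ` F =
      {of_int k + of_int j * (1 / ideal_norm K \<AA>) |j. True}"
  proof (intro equalityI subsetI)
    fix v assume "v \<in> (\<lambda>C. sqrt (real D / of_int \<bar>discriminant K\<bar>) * curvature C) ` F"
    then obtain C where C: "C \<in> through" "eta C = eta C0"
      "v = sqrt (real D / of_int \<bar>discriminant K\<bar>) * curvature C" unfolding G[symmetric] by blast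
    obtain k' where k': "sqrt (real D) * curvature C = S * of_int k'" "admissible (eta C0) k'"
      using obtain_admissible[OF C(1)] C(2) by metis
    then obtain j where "k' - k = n * j" using admissible_shift[OF k(2)] by (auto elim: dvdE)
    then have "k' = k + j * n" by (simp add: algebra_simps)
    moreover have "v = of_int k'" using C(3) k'(1) scaled by simp
    ultimately show "v \<in> {of_int k + of_int j * (1 / ideal_norm K \<AA>) |j. True}"
      unfolding ideal_norm_\<AA> by auto
  next
    fix v assume "v \<in> {of_int k + of_int j * (1 / ideal_norm K \<AA>) |j. True}"
    then obtain j where j: "v = of_int (k + j * n)" unfolding ideal_norm_\<AA> by auto
    have "admissible (eta C0) (k + j * n)" by (simp add: admissible_shift[OF k(2)])
    then obtain C where "C \<in> through" "eta C = eta C0" "sqrt (real D) * curvature C = S * of_int (k + j * n)"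
      by (rule admissible_imp_circle[OF cmod_eta[OF C0']])
    moreover from this(3) have "sqrt (real D / of_int \<bar>discriminant K\<bar>) * curvature C = v"
      unfolding j scaled .
    ultimately show "v \<in> (\<lambda>C. sqrt (real D / of_int \<bar>discriminant K\<bar>) * curvature C) ` F"
      unfolding G[symmetric] by blast
  qed
  then show ?thesis by blast
qed

end

theorem theorem5p3:
  fixes K :: "complex set" and D :: nat and \<alpha> :: complex
  assumes "imaginary_quadratic_field K" and "D > 0" and "\<alpha> \<in> K"
  defines "\<aa> \<equiv> ideal_gen2 K \<alpha> 1"
  shows
    "(\<exists>\<Phi>. bij_betw \<Phi>
            {E. is_extended_family K D E \<and> passes_through E \<alpha>}
            {I. integral_ideal K I \<and> ideal_norm K I = real D \<and>
                I \<in> ideal_class K (ideal_mult \<aa> \<aa>)} \<and>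
          (\<forall>E E'. is_extended_family K D E \<and> passes_through E \<alpha> \<and>
                  is_extended_family K D E' \<and> passes_through E' \<alpha> \<longrightarrow>
             (\<forall>C \<in> E. \<forall>C' \<in> E'.
                \<exists>g. is_generator K g (ideal_quotient K (\<Phi> E) (\<Phi> E')) \<and>
                    circle_angle C C' = \<bar>Arg g\<bar>))) \<and>
     (\<forall>F. is_family K D F \<and> passes_through F \<alpha> \<longrightarrow>
        (\<exists>x. (\<lambda>C. sqrt (real D / of_int \<bar>discriminant K\<bar>) * curvature C) ` F =
             {x + of_int k * (1 / ideal_norm K \<aa>) |k. True}))"
proof -
  interpret imaginary_quadratic K using assms(1) by unfold_locales
  obtain n t m x y z where *: "n > 0" "of_int n * (\<alpha> + cnj \<alpha>) = of_int t"
    "of_int n * (\<alpha> * cnj \<alpha>) = of_int m" "x * n + y * t + z * m = 1"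
    "\<And>k. of_int k * (\<alpha> + cnj \<alpha>) \<in> \<int> \<and> of_int k * (\<alpha> * cnj \<alpha>) \<in> \<int> \<longleftrightarrow> n dvd k"
    by (rule common_denominator[OF K_trace[OF assms(3)] K_norm[OF assms(3)]]) (rule that; blast)
  interpret circles_through_point K \<alpha> n t m x y z D
    by unfold_locales (fact assms(3) * assms(2))+
  show ?thesis
    using bij_betw_family_ideal circle_angle_generator family_curvatures
    unfolding \<aa>_def \<AA>\<AA>_def by (intro conjI exI[of _ family_ideal]) blast+
qed

end
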